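(* Let $(X,e,T)$ be a conditional Riesz triple. Then the universal completion $X^{u}$ of $X$ is complete with respect to convergence in $T$-conditional probability; that is, every net in $X^{u}$ which is Cauchy with respect to convergence in $T$-conditional probability converges in $T$-conditional probability to some element of $X^{u}$.
   Context: A conditional Riesz triple $(X,e,T)$ consists of a Dedekind complete vector lattice (Riesz space) $X$, a weak order unit $e$ of $X$, and a conditional expectation operator $T:X\to X$, i.e. a positive order continuous projection whose range $R(T)$ is a Dedekind complete Riesz subspace of $X$, with $Te=e$; moreover $T$ is assumed strictly positive: $T|x|=0$ if and only if $x=0$. $X^u$ denotes the universal completion of $X$ ($X$ is an order dense ideal of $X^u$). A net $(x_\alpha)$ in a vector lattice is order convergent to $x$ (written $x_\alpha\overset{o}{\longrightarrow}x$) if there is a net $(y_\gamma)_{\gamma\in\Gamma}$ with $y_\gamma\downarrow 0$ such that for each $\gamma$ there is $\alpha_0$ with $|x_\alpha-x|\le y_\gamma$ for all $\alpha\ge\alpha_0$. A net $(x_\alpha)$ in $X^u$ converges to $x\in X^u$ in $T$-conditional probability if for every real $\varepsilon>0$, $T P_{(|x_\alpha-x|-\varepsilon e)^{+}}e\overset{o}{\longrightarrow}0$ in $X$, where $P_{y}$ is the band projection onto the band generated by $y$ in $X^u$. (Known equivalent form: $T(|x_\alpha-x|\wedge e)\overset{o}{\longrightarrow}0$.) A net $(x_\alpha)_{\alpha\in A}$ in $X^u$ is Cauchy with respect to this convergence if the net $(x_\alpha-x_\beta)_{(\alpha,\beta)\in A\times A}$ converges to $0$ in $T$-conditional probabilit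y. *)

theory Defs
  imports Complex_Main "HOL-Library.Lattice_Algebras" "HOL-Library.Lub_Glb"
begin

section \<open>Riesz spaces\<close>

class riesz_space = ordered_real_vector + lattice_ab_group_add_abs

class dedekind_complete_riesz_space = riesz_space + conditionally_complete_lattice

text \<open>Universally complete means Dedekind complete and laterally complete. The empty family is
  excluded because its supremum would be a least element.\<close>

class universally_complete_riesz_space = dedekind_complete_riesz_space +
  assumes laterally_complete:
    "D \<noteq> {} \<Longrightarrow> (\<And>x. x \<in> D \<Longrightarrow> 0 \<le> x) \<Longrightarrow> pairwise (\<lambda>x y. inf x y = 0) D \<Longrightarrow>
      \<exists>s. (\<forall>x\<in>D. x \<le> s) \<and> (\<forall>u. (\<forall>x\<in>D. x \<le> u) \<longrightarrow> s \<le> u)"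

definition riesz_subspace :: "'a::riesz_space set \<Rightarrow> bool" where
  "riesz_subspace S \<longleftrightarrow> subspace S \<and> (\<forall>x\<in>S. \<forall>y\<in>S. sup x y \<in> S \<and> inf x y \<in> S)"

definition riesz_ideal :: "'a::riesz_space set \<Rightarrow> bool" where
  "riesz_ideal I \<longleftrightarrow> subspace I \<and> (\<forall>x y. y \<in> I \<longrightarrow> \<bar>x\<bar> \<le> \<bar>y\<bar> \<longrightarrow> x \<in> I)"

definition band :: "'a::riesz_space set \<Rightarrow> bool" where
  "band B \<longleftrightarrow> riesz_ideal B \<and> (\<forall>D s. D \<subseteq> B \<longrightarrow> isLub UNIV D s \<longrightarrow> s \<in> B)"

definition disjoint_complement :: "'a::riesz_space set \<Rightarrow> 'a set" where
  "disjoint_complement B = {x. \<forall>b\<in>B. inf \<bar>x\<bar> \<bar>b\<bar> = 0}"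

text \<open>In a Dedekind complete Riesz space every band \<open>B\<close> is a projection band, i.e. the space is the
  direct sum of \<open>B\<close> and its disjoint complement, so that the description below is proper.
  The band generated by \<open>y\<close> is \<open>band hull {y}\<close>.\<close>

definition band_projection :: "'a::dedekind_complete_riesz_space set \<Rightarrow> 'a \<Rightarrow> 'a" where
  "band_projection B x = (THE b. b \<in> B \<and> x - b \<in> disjoint_complement B)"

text \<open>Completeness of \<open>S\<close> as an ordered set in its own right: bounds and suprema are taken in \<open>S\<close>.\<close>

definition dedekind_complete_on :: "'a::riesz_space set \<Rightarrow> bool" where
  "dedekind_complete_on S \<longleftrightarrow>
     (\<forall>D\<subseteq>S. D \<noteq> {} \<longrightarrow> (\<exists>u. isUb S D u) \<longrightarrow> (\<exists>s. isLub S D s))"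

definition weak_order_unit :: "'a::riesz_space \<Rightarrow> bool" where
  "weak_order_unit e \<longleftrightarrow> 0 \<le> e \<and> (\<forall>x. inf \<bar>x\<bar> e = 0 \<longrightarrow> x = 0)"


section \<open>Nets and order convergence\<close>

text \<open>A net is a function on a nonempty set \<open>A\<close> directed upwards by a preorder \<open>le\<close>.\<close>

definition directed_set :: "'i set \<Rightarrow> ('i \<Rightarrow> 'i \<Rightarrow> bool) \<Rightarrow> bool" where
  "directed_set A le \<longleftrightarrow> A \<noteq> {} \<and> reflp_on A le \<and> transp_on A le \<and>
     (\<forall>\<alpha>\<in>A. \<forall>\<beta>\<in>A. \<exists>\<gamma>\<in>A. le \<alpha> \<gamma> \<and> le \<beta> \<gamma>)"

definition decreases_to_zero ::
    "'i set \<Rightarrow> ('i \<Rightarrow> 'i \<Rightarrow> bool) \<Rightarrow> ('i \<Rightarrow> 'a::riesz_space) \<Rightarrow> bool" where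
  "decreases_to_zero A le y \<longleftrightarrow>
     directed_set A le \<and> monotone_on A le (\<ge>) y \<and> isGlb UNIV (y ` A) 0"

text \<open>HOL cannot quantify over the index type of the dominating net inside a definition. Indexing it
  by a subset of \<open>'a\<close> is no restriction, since a decreasing net can be reindexed by its
  values; see \<open>order_convergentI\<close>.\<close>

definition order_convergent ::
    "'i set \<Rightarrow> ('i \<Rightarrow> 'i \<Rightarrow> bool) \<Rightarrow> ('i \<Rightarrow> 'a::riesz_space) \<Rightarrow> 'a \<Rightarrow> bool" where
  "order_convergent A le x l \<longleftrightarrow>
     (\<exists>(\<Gamma> :: 'a set) le' y. decreases_to_zero \<Gamma> le' y \<and>
       (\<forall>\<gamma>\<in>\<Gamma>. \<exists>\<alpha>\<^sub>0\<in>A. \<forall>\<alpha>\<in>A. le \<alpha>\<^sub>0 \<alpha> \<longrightarrow> \<bar>x \<alpha> - l\<bar> \<le> y \<gamma>))"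

lemma order_convergentI:
  fixes y :: "'g \<Rightarrow> 'a::riesz_space"
  assumes y: "decreases_to_zero \<Gamma> le' y"
    and dom: "\<And>\<gamma>. \<gamma> \<in> \<Gamma> \<Longrightarrow> \<exists>\<alpha>\<^sub>0\<in>A. \<forall>\<alpha>\<in>A. le \<alpha>\<^sub>0 \<alpha> \<longrightarrow> \<bar>x \<alpha> - l\<bar> \<le> y \<gamma>"
  shows "order_convergent A le x l"
proof -
  have "directed_set (y ` \<Gamma>) (\<ge>)"
    unfolding directed_set_def
  proof (intro conjI ballI)
    show "y ` \<Gamma> \<noteq> {}"
      using y by (auto simp: decreases_to_zero_def directed_set_def)
    show "reflp_on (y ` \<Gamma>) (\<ge>)" "transp_on (y ` \<Gamma>) (\<ge>)"
      by (auto simp: reflp_on_def transp_on_def)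
    fix a b assume "a \<in> y ` \<Gamma>" "b \<in> y ` \<Gamma>"
    then obtain \<gamma> \<delta> where g: "\<gamma> \<in> \<Gamma>" "\<delta> \<in> \<Gamma>" "a = y \<gamma>" "b = y \<delta>" by auto
    then obtain \<eta> where "\<eta> \<in> \<Gamma>" "le' \<gamma> \<eta>" "le' \<delta> \<eta>"
      using y unfolding decreases_to_zero_def directed_set_def by meson
    then show "\<exists>c\<in>y ` \<Gamma>. a \<ge> c \<and> b \<ge> c"
      using y g unfolding decreases_to_zero_def monotone_on_def by blast
  qed
  then have "decreases_to_zero (y ` \<Gamma>) (\<ge>) (\<lambda>a. a)"
    using y by (auto simp: decreases_to_zero_def monotone_on_def)
  then show ?thesis
    using dom unfolding order_convergent_def
    by (intro exI[of _ "y ` \<Gamma>"] exI[of _ "(\<ge>)"] exI[of _ "\<lambda>a. a"]) auto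
qed

text \<open>Only nets indexed by subsets of \<open>'a\<close> are tested here; for positive operators this implies the
  property for nets over arbitrary index types, see \<open>positive_order_continuous\<close>.\<close>

definition order_continuous :: "('a::riesz_space \<Rightarrow> 'a) \<Rightarrow> bool" where
  "order_continuous T \<longleftrightarrow>
     (\<forall>(A :: 'a set) le x l. directed_set A le \<longrightarrow> order_convergent A le x l \<longrightarrow>
        order_convergent A le (\<lambda>\<alpha>. T (x \<alpha>)) (T l))"

definition positive_operator :: "('a::riesz_space \<Rightarrow> 'a) \<Rightarrow> bool" where
  "positive_operator T \<longleftrightarrow> linear T \<and> (\<forall>x. 0 \<le> x \<longrightarrow> 0 \<le> T x)"

lemma positive_operator_mono:
  assumes "positive_operator T" "x \<le> y" shows "T x \<le> T y"
proof -
  have "0 \<le> T (y - x)" using assms by (simp add: positive_operator_def)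
  then show ?thesis using assms by (simp add: positive_operator_def linear_diff)
qed

lemma positive_order_continuous:
  fixes x :: "'i \<Rightarrow> 'a::riesz_space"
  assumes T: "positive_operator T" "order_continuous T"
    and x: "order_convergent A le x l"
  shows "order_convergent A le (\<lambda>\<alpha>. T (x \<alpha>)) (T l)"
proof -
  have lin: "linear T" using T by (simp add: positive_operator_def)
  obtain \<Gamma> :: "'a set" and le' y where y: "decreases_to_zero \<Gamma> le' y"
    and dom: "\<And>\<gamma>. \<gamma> \<in> \<Gamma> \<Longrightarrow> \<exists>\<alpha>\<^sub>0\<in>A. \<forall>\<alpha>\<in>A. le \<alpha>\<^sub>0 \<alpha> \<longrightarrow> \<bar>x \<alpha> - l\<bar> \<le> y \<gamma>"
    using x unfolding order_convergent_def by blast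
  have dir: "directed_set \<Gamma> le'" and mono: "monotone_on \<Gamma> le' (\<ge>) y"
    and glb: "isGlb UNIV (y ` \<Gamma>) 0"
    using y by (auto simp: decreases_to_zero_def)
  have y0: "0 \<le> y \<gamma>" if "\<gamma> \<in> \<Gamma>" for \<gamma>
    using glb that by (auto simp: isGlb_def greatestP_def isLb_def setge_def)
  have "order_convergent \<Gamma> le' y 0"
  proof (rule order_convergentI[OF y])
    fix \<gamma> assume "\<gamma> \<in> \<Gamma>"
    then show "\<exists>\<alpha>\<^sub>0\<in>\<Gamma>. \<forall>\<alpha>\<in>\<Gamma>. le' \<alpha>\<^sub>0 \<alpha> \<longrightarrow> \<bar>y \<alpha> - 0\<bar> \<le> y \<gamma>"
      using mono y0 by (intro bexI[of _ \<gamma>]) (auto simp: monotone_on_def abs_of_nonneg)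
  qed
  with T(2) dir have "order_convergent \<Gamma> le' (\<lambda>\<gamma>. T (y \<gamma>)) (T 0)"
    unfolding order_continuous_def by blast
  then have Ty: "order_convergent \<Gamma> le' (\<lambda>\<gamma>. T (y \<gamma>)) 0"
    using lin by (simp add: linear_0)
  then obtain \<Delta> :: "'a set" and le'' z where z: "decreases_to_zero \<Delta> le'' z"
    and zdom: "\<And>\<delta>. \<delta> \<in> \<Delta> \<Longrightarrow> \<exists>\<gamma>\<^sub>0\<in>\<Gamma>. \<forall>\<gamma>\<in>\<Gamma>. le' \<gamma>\<^sub>0 \<gamma> \<longrightarrow> \<bar>T (y \<gamma>) - 0\<bar> \<le> z \<delta>"
    unfolding order_convergent_def by blast
  show ?thesis
  proof (rule order_convergentI[OF z])
    fix \<delta> assume "\<delta> \<in> \<Delta>"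
    then obtain \<gamma> where \<gamma>: "\<gamma> \<in> \<Gamma>" "\<forall>\<gamma>'\<in>\<Gamma>. le' \<gamma> \<gamma>' \<longrightarrow> \<bar>T (y \<gamma>') - 0\<bar> \<le> z \<delta>"
      using zdom by blast
    have "le' \<gamma> \<gamma>" using dir \<gamma>(1) by (auto simp: directed_set_def reflp_on_def)
    with \<gamma> have "\<bar>T (y \<gamma>)\<bar> \<le> z \<delta>" by auto
    then have Tz: "T (y \<gamma>) \<le> z \<delta>" using abs_ge_self order_trans by blast
    obtain \<alpha>\<^sub>0 where a: "\<alpha>\<^sub>0 \<in> A" "\<And>\<alpha>. \<alpha> \<in> A \<Longrightarrow> le \<alpha>\<^sub>0 \<alpha> \<Longrightarrow> \<bar>x \<alpha> - l\<bar> \<le> y \<gamma>"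
      using dom[OF \<gamma>(1)] by blast
    have "\<bar>T (x \<alpha>) - T l\<bar> \<le> z \<delta>" if "\<alpha> \<in> A" "le \<alpha>\<^sub>0 \<alpha>" for \<alpha>
    proof -
      have "\<bar>x \<alpha> - l\<bar> \<le> y \<gamma>" by (rule a(2)[OF that])
      then have "x \<alpha> - l \<le> y \<gamma>" "- (x \<alpha> - l) \<le> y \<gamma>"
        by (meson abs_ge_self abs_ge_minus_self order_trans)+
      then have "T (x \<alpha> - l) \<le> T (y \<gamma>)" "T (- (x \<alpha> - l)) \<le> T (y \<gamma>)"
        by (auto intro: positive_operator_mono[OF T(1)])
      then have "T (x \<alpha>) - T l \<le> T (y \<gamma>)" "- (T (x \<alpha>) - T l) \<le> T (y \<gamma>)"
        using lin by (simp_all add: linear_diff)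
      then have "\<bar>T (x \<alpha>) - T l\<bar> \<le> T (y \<gamma>)" by (simp only: abs_leI)
      then show ?thesis using Tz by (rule order_trans)
    qed
    then show "\<exists>\<alpha>\<^sub>0\<in>A. \<forall>\<alpha>\<in>A. le \<alpha>\<^sub>0 \<alpha> \<longrightarrow> \<bar>T (x \<alpha>) - T l\<bar> \<le> z \<delta>"
      using a(1) by blast
  qed
qed


section \<open>Conditional Riesz triples and universal completions\<close>

text \<open>The Riesz space \<open>X\<close> of the triple is the type \<open>'a\<close>.\<close>

definition conditional_expectation ::
    "'a::dedekind_complete_riesz_space \<Rightarrow> ('a \<Rightarrow> 'a) \<Rightarrow> bool" where
  "conditional_expectation e T \<longleftrightarrow>
     positive_operator T \<and> order_continuous T \<and> (\<forall>x. T (T x) = T x) \<and>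
     riesz_subspace (range T) \<and> dedekind_complete_on (range T) \<and> T e = e"

definition conditional_riesz_triple ::
    "'a::dedekind_complete_riesz_space \<Rightarrow> ('a \<Rightarrow> 'a) \<Rightarrow> bool" where
  "conditional_riesz_triple e T \<longleftrightarrow>
     weak_order_unit e \<and> conditional_expectation e T \<and> (\<forall>x. T \<bar>x\<bar> = 0 \<longleftrightarrow> x = 0)"

text \<open>\<open>'u\<close> is a universal completion of \<open>'a\<close> via the embedding \<open>j\<close>, which identifies \<open>'a\<close> with an
  order dense Riesz subspace of the universally complete space \<open>'u\<close>. That the image is an
  ideal follows from Dedekind completeness of \<open>'a\<close>, see \<open>universal_completion_ideal\<close>.\<close>

definition universal_completion ::
    "('a::dedekind_complete_riesz_space \<Rightarrow> 'u::universally_complete_riesz_space) \<Rightarrow> bool" where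
  "universal_completion j \<longleftrightarrow>
     linear j \<and> inj j \<and> (\<forall>x y. j (sup x y) = sup (j x) (j y)) \<and>
     (\<forall>u>0. \<exists>x. 0 < j x \<and> j x \<le> u)"

lemma universal_completion_ideal:
  fixes j :: "'a::dedekind_complete_riesz_space \<Rightarrow> 'u::universally_complete_riesz_space"
  assumes j: "universal_completion j"
  shows "riesz_ideal (range j)"
proof -
  have lin: "linear j" and inj: "inj j" and jsup: "\<And>x y. j (sup x y) = sup (j x) (j y)"
    and dense: "\<And>u. 0 < u \<Longrightarrow> \<exists>x. 0 < j x \<and> j x \<le> u"
    using j by (auto simp: universal_completion_def)
  have j_le: "j x \<le> j y \<longleftrightarrow> x \<le> y" for x y
    by (metis jsup inj injD le_iff_sup)
  have j0: "j 0 = 0" using lin by (rule linear_0)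
  have j_less: "0 < j x \<longleftrightarrow> 0 < x" for x
    using j_le[of 0 x] j_le[of x 0] by (simp add: j0 less_le_not_le)
  have pos: "u \<in> range j" if u: "0 \<le> u" "u \<le> j a" for u a
  proof -
    define S where "S = {x. 0 \<le> x \<and> j x \<le> u}"
    have S0: "0 \<in> S" using u by (simp add: S_def j0)
    have Sa: "x \<le> a" if "x \<in> S" for x
    proof -
      have "j x \<le> j a" using that u(2) by (auto simp: S_def intro: order_trans)
      then show ?thesis by (simp add: j_le)
    qed
    have bdd: "bdd_above S" using Sa by (auto simp: bdd_above_def)
    define s where "s = Sup S"
    have s0: "0 \<le> s" unfolding s_def using S0 bdd by (rule cSup_upper)
    have le: "j s \<le> u"
    proof (rule ccontr)
      assume "\<not> j s \<le> u"
      define w where "w = pprt (j s - u)"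
      have "w \<noteq> 0" using \<open>\<not> j s \<le> u\<close> unfolding w_def
        by (metis diff_le_0_iff_le le_zero_iff_zero_pprt)
      then have "0 < w" by (simp add: w_def less_le)
      then obtain b where b: "0 < j b" "j b \<le> w" using dense by blast
      have "x \<le> s - b" if "x \<in> S" for x
      proof -
        have "x \<le> s" unfolding s_def using that bdd by (rule cSup_upper)
        then have "j x \<le> j s" by (simp add: j_le)
        moreover have "j x \<le> u" using that by (simp add: S_def)
        ultimately have "w \<le> j s - j x" by (simp add: w_def pprt_def)
        with b have "j b \<le> j (s - x)" using lin by (simp add: linear_diff)
        then have "b \<le> s - x" by (simp add: j_le)
        then show ?thesis by (simp add: algebra_simps)
      qed
      then have "s \<le> s - b" unfolding s_def using S0 by (intro cSup_least) auto
      then have "b \<le> 0" by simp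
      with b(1) show False by (simp add: j_less)
    qed
    have "j s = u"
    proof (rule ccontr)
      assume "j s \<noteq> u"
      with le have "0 < u - j s" by (simp add: less_le)
      then obtain b where b: "0 < j b" "j b \<le> u - j s" using dense by blast
      have "j (s + b) \<le> u" using b(2) lin by (simp add: linear_add algebra_simps)
      moreover have "0 \<le> s + b" using s0 b(1) by (simp add: j_less)
      ultimately have "s + b \<in> S" by (simp add: S_def)
      then have "s + b \<le> s" unfolding s_def using bdd by (rule cSup_upper)
      with b(1) show False by (simp add: j_less)
    qed
    then show ?thesis by blast
  qed
  have sub: "subspace (range j)" using lin by (simp add: linear_subspace_image)
  have "u \<in> range j" if v: "v \<in> range j" and uv: "\<bar>u\<bar> \<le> \<bar>v\<bar>" for u v
  proof -
    obtain a where a: "v = j a" using v by blast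
    have abs: "\<bar>v\<bar> = j \<bar>a\<bar>" using lin by (simp add: a abs_lattice jsup linear_neg)
    have "pprt u \<le> \<bar>u\<bar>" "pprt (- u) \<le> \<bar>u\<bar>" by (simp_all add: pprt_def abs_ge_self abs_ge_minus_self)
    with uv have "pprt u \<le> j \<bar>a\<bar>" "pprt (- u) \<le> j \<bar>a\<bar>"
      unfolding abs by (meson order_trans)+
    then have "pprt u \<in> range j" "pprt (- u) \<in> range j" by (auto intro: pos)
    then have "pprt u - pprt (- u) \<in> range j" using sub by (rule subspace_diff[rotated])
    moreover have "pprt u - pprt (- u) = u" by (metis pprt_neg prts diff_minus_eq_add)
    ultimately show ?thesis by simp
  qed
  with sub show ?thesis unfolding riesz_ideal_def by blast
qed


section \<open>Convergence in conditional probability\<close>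

text \<open>\<open>inv j\<close> carries the component \<open>P e\<close>, which lies between \<open>0\<close> and \<open>e\<close>, back to \<open>X\<close>, where \<open>T\<close>
  acts and where the order limit is taken.\<close>

definition converges_in_cond_prob ::
    "('a::dedekind_complete_riesz_space \<Rightarrow> 'u::universally_complete_riesz_space) \<Rightarrow> 'a \<Rightarrow> ('a \<Rightarrow> 'a) \<Rightarrow>
     'i set \<Rightarrow> ('i \<Rightarrow> 'i \<Rightarrow> bool) \<Rightarrow> ('i \<Rightarrow> 'u) \<Rightarrow> 'u \<Rightarrow> bool" where
  "converges_in_cond_prob j e T A le x l \<longleftrightarrow>
     (\<forall>\<epsilon>::real. 0 < \<epsilon> \<longrightarrow>
        order_convergent A le
          (\<lambda>\<alpha>. T (inv j (band_projection (band hull {pprt (\<bar>x \<alpha> - l\<bar> - \<epsilon> *\<^sub>R j e)}) (j e)))) 0)"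

definition cauchy_in_cond_prob ::
    "('a::dedekind_complete_riesz_space \<Rightarrow> 'u::universally_complete_riesz_space) \<Rightarrow> 'a \<Rightarrow> ('a \<Rightarrow> 'a) \<Rightarrow>
     'i set \<Rightarrow> ('i \<Rightarrow> 'i \<Rightarrow> bool) \<Rightarrow> ('i \<Rightarrow> 'u) \<Rightarrow> bool" where
  "cauchy_in_cond_prob j e T A le x \<longleftrightarrow>
     converges_in_cond_prob j e T (A \<times> A) (\<lambda>(\<alpha>, \<beta>) (\<alpha>', \<beta>'). le \<alpha> \<alpha>' \<and> le \<beta> \<beta>')
       (\<lambda>(\<alpha>, \<beta>). x \<alpha> - x \<beta>) 0"

end

theory Submission
  imports Defs
begin

text \<open>Identify \<open>X\<close> with its image in the completion, and for \<open>0 \<le> u\<close> put \<open>rho u = T (inf u e)\<close>.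
  Convergence in conditional probability is order convergence to \<open>0\<close> of \<open>rho \<bar>x \<alpha> - l\<bar>\<close>, by a Chebyshev
  estimate (\<open>converges_in_cond_prob_iff_rho\<close>), and \<open>rho\<close> is a monotone, subadditive quantity that vanishes only at
  \<open>0\<close> because \<open>T\<close> is strictly positive. So \<open>rho \<bar>u - v\<bar>\<close> is a metric with values in the range of
  \<open>T\<close>. As for \<open>L\<^sup>0\<close> of a probability space, one extracts a fast Cauchy sequence and sums its increments;
  each of the two steps needs a local version because the values of the metric are not numbers.

  To pass from the net to a sequence, consider the oscillations
  \<open>q \<alpha> = sup {rho \<bar>x \<beta> - x \<gamma>\<bar> | \<beta>, \<gamma> \<ge> \<alpha>}\<close>. They have infimum \<open>0\<close>, but no single \<open>q \<alpha>\<close> need be below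
  \<open>c e\<close>. The components of \<open>e\<close> on which \<open>q \<alpha> \<le> c e\<close> do cover \<open>e\<close>, however, and as \<open>q \<alpha>\<close> is fixed
  by \<open>T\<close> so are these components. Made disjoint along a well-order of the index set
  (\<open>disjoint_refinement\<close>), they allow one to glue a single element \<open>z\<close> from the corresponding \<open>x \<alpha>\<close>
  by lateral completeness (\<open>mixing\<close>). Since \<open>T\<close> respects \<open>T\<close>-invariant components
  (\<open>rho_disjoint\<close>), the net is eventually within \<open>c\<close> of \<open>z\<close> on each piece
  (\<open>cauchy_locally_near\<close>). Two such elements, for \<open>c\<close> and \<open>c'\<close>, satisfy
  \<open>rho \<bar>z - z'\<bar> \<le> (c + c') e\<close> globally (\<open>locally_near_dist\<close>).

  This gives a sequence with \<open>rho \<bar>z (n + 1) - z n\<bar> \<le> (1/4)\<^sup>n e\<close>. The series of its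
  absolute increments is bounded in the universal completion: by Borel--Cantelli it is bounded on
  each member of a countable family of components covering \<open>e\<close>, and mixing turns the local bounds into one
  bound (\<open>summable_bounded\<close>). Hence the sequence converges, with an estimate of \<open>rho \<bar>z n - l\<bar>\<close> that
  comes from order continuity of \<open>T\<close> (\<open>rho_lub_le\<close>), and its limit \<open>l\<close> is the limit of the net
  (\<open>converges_of_locally_near\<close>).\<close>

section \<open>Disjointness in Riesz spaces\<close>

lemma inf_add_le:
  fixes x y z :: "'a::riesz_space"
  assumes "0 \<le> x" "0 \<le> y" "0 \<le> z"
  shows "inf x (y + z) \<le> inf x y + inf x z"
proof -
  have "inf x (y + z) \<le> x + x" "inf x (y + z) \<le> x + z" "inf x (y + z) \<le> y + x"
    using assms by (auto intro: le_infI1 add_increasing add_increasing2)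
  then show ?thesis by (simp add: add_sup_inf_distribs)
qed

lemma disjoint_mono:
  fixes x y p q :: "'a::riesz_space"
  assumes "inf y p = 0" "0 \<le> x" "x \<le> y" "0 \<le> q" "q \<le> p"
  shows "inf x q = 0"
proof -
  have "inf x q \<le> inf y p" using assms by (intro inf_mono) auto
  then show ?thesis using assms by (intro antisym) auto
qed

lemma disjoint_add:
  fixes x y p :: "'a::riesz_space"
  assumes "0 \<le> x" "0 \<le> y" "0 \<le> p" "inf x p = 0" "inf y p = 0"
  shows "inf (x + y) p = 0"
proof -
  have "inf p (x + y) \<le> inf p x + inf p y" using assms by (intro inf_add_le)
  then have "inf (x + y) p \<le> 0" using assms by (simp add: inf_commute)
  then show ?thesis using assms by (intro antisym) auto
qed

lemma disjoint_scaleR: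
  fixes x p :: "'a::riesz_space"
  assumes "0 \<le> x" "0 \<le> p" "inf x p = 0" "0 \<le> c"
  shows "inf (c *\<^sub>R x) p = 0"
proof -
  have nat: "inf (real n *\<^sub>R x) p = 0" for n
  proof (induction n)
    case 0
    then show ?case using assms by (simp add: inf_absorb1)
  next
    case (Suc n)
    then have "inf (real n *\<^sub>R x + x) p = 0"
      using assms by (intro disjoint_add) (auto intro: scaleR_nonneg_nonneg)
    then show ?case by (simp add: algebra_simps)
  qed
  obtain n where n: "c \<le> real n" using real_arch_simple by blast
  show ?thesis
    by (rule disjoint_mono[OF nat[of n]])
      (use assms n in \<open>auto intro: scaleR_nonneg_nonneg scaleR_right_mono\<close>)
qed

lemma disjoint_add_eq_sup:
  fixes x y :: "'a::riesz_space"
  assumes "inf x y = 0"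
  shows "x + y = sup x y"
  using add_eq_inf_sup[of x y] assms by simp

lemma disjoint_le_diff:
  fixes f p e :: "'a::riesz_space"
  assumes "inf f p = 0" "f \<le> e" "p \<le> e"
  shows "f \<le> e - p"
proof -
  have "f + p \<le> e" using assms by (simp add: disjoint_add_eq_sup)
  then show ?thesis by (simp add: algebra_simps)
qed

lemma disjoint_pprts:
  fixes u :: "'a::riesz_space"
  shows "inf (pprt u) (pprt (- u)) = 0"
proof -
  have "pprt (- u) = pprt u - u"
    using prts[of u] by (simp add: pprt_neg algebra_simps)
  then have "inf (pprt u) (pprt (- u)) = pprt u + inf 0 (- u)"
    by (simp add: add_inf_distrib_left)
  also have "inf 0 (- u) = - pprt u" by (simp add: pprt_def sup_commute)
  finally show ?thesis by simp
qed

lemma pprt_add_le: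
  fixes u v :: "'a::riesz_space"
  shows "pprt (u + v) \<le> pprt u + pprt v"
  unfolding pprt_def by (intro sup_least add_mono add_nonneg_nonneg) auto

lemma pprt_le_abs:
  fixes u :: "'a::riesz_space"
  shows "pprt u \<le> \<bar>u\<bar>"
  by (simp add: pprt_def abs_ge_self)

text \<open>A supremum inherits disjointness because \<open>w = inf s f\<close> can be subtracted from the upper bound
  \<open>s\<close>: for disjoint positive \<open>d\<close> and \<open>w\<close> one has \<open>d + w = sup d w \<le> s\<close>.\<close>

lemma disjoint_lub:
  fixes f s :: "'a::riesz_space"
  assumes ub: "\<And>d. d \<in> D \<Longrightarrow> d \<le> s" and least: "\<And>u. (\<And>d. d \<in> D \<Longrightarrow> d \<le> u) \<Longrightarrow> s \<le> u"
    and "D \<noteq> {}" and pos: "\<And>d. d \<in> D \<Longrightarrow> 0 \<le> d" and "0 \<le> f"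
    and disj: "\<And>d. d \<in> D \<Longrightarrow> inf d f = 0"
  shows "inf s f = 0"
proof -
  define w where "w = inf s f"
  obtain d where "d \<in> D" using \<open>D \<noteq> {}\<close> by blast
  then have "0 \<le> s" using ub pos order_trans by blast
  then have w: "0 \<le> w" "w \<le> s" "w \<le> f" using \<open>0 \<le> f\<close> by (auto simp: w_def)
  have "d \<le> s - w" if d: "d \<in> D" for d
    by (rule disjoint_le_diff[OF disjoint_mono[OF disj[OF d]]]) (use w pos ub d in auto)
  then have "s \<le> s - w" by (rule least)
  then have "w \<le> 0" by simp
  then show ?thesis using w(1) unfolding w_def by (rule antisym)
qed

text \<open>The inequality \<open>u \<le> v\<close> restricted to the band generated by \<open>p\<close>. Inequalities of this kind are
  added and chained like ordinary ones, and they are used in place of band projections.\<close>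

definition le_on :: "'a::riesz_space \<Rightarrow> 'a \<Rightarrow> 'a \<Rightarrow> bool" where
  "le_on p u v \<longleftrightarrow> inf (pprt (u - v)) p = 0"

lemma le_on_of_le: "0 \<le> p \<Longrightarrow> u \<le> v \<Longrightarrow> le_on p u v"
  by (simp add: le_on_def inf_absorb1)

lemma le_on_antimono: "le_on p u v \<Longrightarrow> 0 \<le> q \<Longrightarrow> q \<le> p \<Longrightarrow> le_on q u v"
  unfolding le_on_def by (rule disjoint_mono) auto

lemma le_on_add:
  assumes "0 \<le> p" "le_on p u v" "le_on p u' v'"
  shows "le_on p (u + u') (v + v')"
proof -
  have "inf (pprt (u - v) + pprt (u' - v')) p = 0"
    using assms by (intro disjoint_add) (auto simp: le_on_def)
  moreover have "pprt (u + u' - (v + v')) \<le> pprt (u - v) + pprt (u' - v')"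
    using pprt_add_le[of "u - v" "u' - v'"] by (simp add: algebra_simps)
  ultimately show ?thesis
    using assms unfolding le_on_def by (elim disjoint_mono) auto
qed

lemma le_on_trans:
  assumes "0 \<le> p" "le_on p u v" "le_on p v w"
  shows "le_on p u w"
  using le_on_add[OF assms] by (simp add: le_on_def algebra_simps)

lemma le_on_sum:
  assumes "0 \<le> p" "\<And>k. k \<in> K \<Longrightarrow> le_on p (f k) (g k)"
  shows "le_on p (sum f K) (sum g K)"
  using assms(2)
proof (induction K rule: infinite_finite_induct)
  case (insert k K)
  then show ?case using assms(1) by (simp add: le_on_add)
qed (use assms(1) in \<open>auto intro: le_on_of_le\<close>)


section \<open>Components and band projections in Dedekind complete Riesz spaces\<close>

lemma riesz_archimedean:
  fixes x y :: "'a::dedekind_complete_riesz_space"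
  assumes "\<And>n::nat. real (Suc n) *\<^sub>R x \<le> y"
  shows "x \<le> 0"
proof -
  define D where "D = range (\<lambda>n::nat. real (Suc n) *\<^sub>R x)"
  have bdd: "bdd_above D" using assms by (auto simp: D_def bdd_above_def)
  have "Sup D \<le> Sup D - x"
  proof (rule cSup_least)
    show "D \<noteq> {}" by (simp add: D_def)
    fix d assume "d \<in> D"
    then obtain n where d: "d = real (Suc n) *\<^sub>R x" by (auto simp: D_def)
    have "real (Suc (Suc n)) *\<^sub>R x \<le> Sup D"
      using bdd by (intro cSup_upper) (auto simp: D_def simp del: of_nat_Suc)
    moreover have "real (Suc (Suc n)) *\<^sub>R x = d + x" by (simp add: d algebra_simps flip: scaleR_2)
    ultimately show "d \<le> Sup D - x" by (simp only: le_diff_eq)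
  qed
  then show ?thesis by simp
qed

lemma le_zero_of_le_scaleR:
  fixes w e :: "'a::dedekind_complete_riesz_space"
  assumes "\<And>c::real. 0 < c \<Longrightarrow> w \<le> c *\<^sub>R e"
  shows "w \<le> 0"
proof (rule riesz_archimedean)
  fix n :: nat
  have "real (Suc n) *\<^sub>R w \<le> real (Suc n) *\<^sub>R ((1 / real (Suc n)) *\<^sub>R e)"
    by (intro scaleR_left_mono assms) auto
  then show "real (Suc n) *\<^sub>R w \<le> e" by (simp del: of_nat_Suc)
qed

lemma disjoint_Sup:
  fixes f :: "'a::dedekind_complete_riesz_space"
  assumes "bdd_above D" "D \<noteq> {}" "\<And>d. d \<in> D \<Longrightarrow> 0 \<le> d" "0 \<le> f" "\<And>d. d \<in> D \<Longrightarrow> inf d f = 0"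
  shows "inf (Sup D) f = 0"
  by (rule disjoint_lub[where D = D]) (use assms in \<open>auto intro: cSup_upper cSup_least\<close>)

lemma band_Inter:
  assumes "\<And>S. S \<in> \<F> \<Longrightarrow> band S"
  shows "band (\<Inter> \<F>)"
  unfolding band_def
proof (intro conjI allI impI)
  show "riesz_ideal (\<Inter> \<F>)"
    using assms unfolding band_def riesz_ideal_def
    by (intro conjI allI impI subspace_Inter) blast+
  show "s \<in> \<Inter> \<F>" if "D \<subseteq> \<Inter> \<F>" "isLub UNIV D s" for D s
    using assms that unfolding band_def by blast
qed

text \<open>For a supremum \<open>s\<close> of possibly negative elements, \<open>pprt s\<close> is the supremum of the positive parts,
  and \<open>pprt (- s)\<close> lies below \<open>\<bar>d\<bar>\<close> for any single member \<open>d\<close>.\<close>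

lemma band_disjoint_from:
  fixes f :: "'a::dedekind_complete_riesz_space"
  assumes f: "0 \<le> f"
  shows "band {x. inf \<bar>x\<bar> f = 0}"
  unfolding band_def
proof (intro conjI allI impI)
  show "riesz_ideal {x. inf \<bar>x\<bar> f = 0}"
    unfolding riesz_ideal_def subspace_def
  proof (intro conjI ballI allI impI)
    show "0 \<in> {x. inf \<bar>x\<bar> f = 0}" using f by (simp add: inf_absorb1)
    show "x + z \<in> {x. inf \<bar>x\<bar> f = 0}"
      if "x \<in> {x. inf \<bar>x\<bar> f = 0}" "z \<in> {x. inf \<bar>x\<bar> f = 0}" for x z
    proof -
      have "inf (\<bar>x\<bar> + \<bar>z\<bar>) f = 0" using that f by (intro disjoint_add) auto
      then have "inf \<bar>x + z\<bar> f = 0"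
        using f by (elim disjoint_mono) (auto intro: abs_triangle_ineq)
      then show ?thesis by simp
    qed
    show "c *\<^sub>R x \<in> {x. inf \<bar>x\<bar> f = 0}" if "x \<in> {x. inf \<bar>x\<bar> f = 0}" for c x
    proof -
      have c: "inf (\<bar>c\<bar> *\<^sub>R \<bar>x\<bar>) f = 0" using that f by (intro disjoint_scaleR) auto
      have "c *\<^sub>R x \<le> \<bar>c\<bar> *\<^sub>R \<bar>x\<bar> \<and> - (c *\<^sub>R x) \<le> \<bar>c\<bar> *\<^sub>R \<bar>x\<bar>"
      proof (cases "0 \<le> c")
        case True
        then show ?thesis
          using scaleR_left_mono[OF abs_ge_self, of c x] scaleR_left_mono[OF abs_ge_minus_self, of c x]
          by simp
      next
        case False
        then show ?thesis
          using scaleR_left_mono[OF abs_ge_self, of "- c" x]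
            scaleR_left_mono[OF abs_ge_minus_self, of "- c" x]
          by simp
      qed
      then have "\<bar>c *\<^sub>R x\<bar> \<le> \<bar>c\<bar> *\<^sub>R \<bar>x\<bar>" by (auto intro: abs_leI)
      then have "inf \<bar>c *\<^sub>R x\<bar> f = 0" using f by (intro disjoint_mono[OF c]) auto
      then show ?thesis by simp
    qed
    show "x \<in> {x. inf \<bar>x\<bar> f = 0}" if "z \<in> {x. inf \<bar>x\<bar> f = 0}" "\<bar>x\<bar> \<le> \<bar>z\<bar>" for x z
      using that f by (auto elim: disjoint_mono)
  qed
  show "s \<in> {x. inf \<bar>x\<bar> f = 0}" if D: "D \<subseteq> {x. inf \<bar>x\<bar> f = 0}" and s: "isLub UNIV D s" for D s
  proof -
    have ub: "\<And>d. d \<in> D \<Longrightarrow> d \<le> s" and least: "\<And>v. (\<And>d. d \<in> D \<Longrightarrow> d \<le> v) \<Longrightarrow> s \<le> v"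
      using s by (auto simp: isLub_def leastP_def isUb_def setle_def setge_def)
    show ?thesis
    proof (cases "D = {}")
      case True
      then have "s = 0" using least[of 0] least[of "s + s"] by auto
      then show ?thesis using f by (simp add: inf_absorb1)
    next
      case False
      then obtain d where d: "d \<in> D" by blast
      have "inf (pprt s) f = 0"
      proof (rule disjoint_lub)
        show "pprt ` D \<noteq> {}" using False by simp
        show "\<And>d. d \<in> pprt ` D \<Longrightarrow> d \<le> pprt s" using ub by auto
        show "\<And>d. d \<in> pprt ` D \<Longrightarrow> inf d f = 0"
          using D f by (auto intro: disjoint_mono[OF _ _ pprt_le_abs])
        show "pprt s \<le> v" if v: "\<And>d. d \<in> pprt ` D \<Longrightarrow> d \<le> v" for v
        proof -
          have "d \<le> v" if "d \<in> D" for d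
            using v[of "pprt d"] that by (auto simp: pprt_def)
          then have "s \<le> v" by (rule least)
          moreover have "0 \<le> v" using v[of "pprt d"] d by (auto simp: pprt_def)
          ultimately show ?thesis by (simp add: pprt_def)
        qed
      qed (use f in auto)
      moreover have "inf (pprt (- s)) f = 0"
      proof (rule disjoint_mono)
        show "inf \<bar>d\<bar> f = 0" using d D by auto
        show "pprt (- s) \<le> \<bar>d\<bar>"
          using order_trans[OF _ pprt_le_abs[of "- d"], of "pprt (- s)"] ub[OF d] by simp
      qed (use f in auto)
      ultimately have "inf (pprt s + pprt (- s)) f = 0" using f by (intro disjoint_add) auto
      then show ?thesis by (simp add: abs_prts pprt_neg)
    qed
  qed
qed

text \<open>The projection of a positive \<open>u\<close> onto the band generated by a positive \<open>y\<close>.\<close>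

definition band_part :: "'a::dedekind_complete_riesz_space \<Rightarrow> 'a \<Rightarrow> 'a" where
  "band_part y u = (SUP n::nat. inf u (real n *\<^sub>R y))"

context
  fixes y u :: "'a::dedekind_complete_riesz_space"
  assumes y: "0 \<le> y" and u: "0 \<le> u"
begin

lemma band_part_upper: "inf u (real n *\<^sub>R y) \<le> band_part y u"
  unfolding band_part_def by (rule cSUP_upper) (auto intro!: bdd_aboveI[of _ u])

lemma band_part_le: "band_part y u \<le> u"
  unfolding band_part_def by (rule cSUP_least) auto

lemma band_part_nonneg: "0 \<le> band_part y u"
  using band_part_upper[of 0] u by (simp add: inf_absorb2)

lemma inf_le_band_part: "inf u y \<le> band_part y u"
  using band_part_upper[of 1] by simp

text \<open>Adding \<open>inf (u - b) y\<close> to the \<open>n\<close>-th approximant stays below the next one.\<close>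

lemma band_part_residue_disjoint: "inf (u - band_part y u) y = 0"
proof -
  define b where "b = band_part y u"
  define w where "w = inf (u - b) y"
  have bu: "b \<le> u" using band_part_le by (simp add: b_def)
  have "b \<le> b - w"
    unfolding b_def[unfolded band_part_def]
  proof (rule cSUP_least)
    fix n :: nat
    have "inf u (real n *\<^sub>R y) + w \<le> real n *\<^sub>R y + y" by (intro add_mono) (auto simp: w_def)
    moreover have "inf u (real n *\<^sub>R y) + w \<le> b + (u - b)"
      using band_part_upper[of n] by (intro add_mono) (auto simp: w_def b_def)
    ultimately have "inf u (real n *\<^sub>R y) + w \<le> inf u (real (Suc n) *\<^sub>R y)"
      by (simp add: algebra_simps)
    also have "\<dots> \<le> b" unfolding b_def by (rule band_part_upper)
    finally show "inf u (real n *\<^sub>R y) \<le> (SUP n. inf u (real n *\<^sub>R y)) - w"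
      by (simp add: b_def band_part_def algebra_simps)
  qed simp
  then have "w \<le> 0" by simp
  moreover have "0 \<le> w" using bu y by (simp add: w_def)
  ultimately show ?thesis unfolding w_def b_def by (rule antisym)
qed

lemma band_part_disjoint:
  assumes "inf y f = 0" "0 \<le> f"
  shows "inf (band_part y u) f = 0"
  unfolding band_part_def
proof (rule disjoint_Sup)
  show "bdd_above (range (\<lambda>n. inf u (real n *\<^sub>R y)))" by (auto intro!: bdd_aboveI[of _ u])
  fix d assume "d \<in> range (\<lambda>n. inf u (real n *\<^sub>R y))"
  then obtain n where d: "d = inf u (real n *\<^sub>R y)" by blast
  have n: "inf (real n *\<^sub>R y) f = 0" using assms y by (intro disjoint_scaleR) auto
  show "0 \<le> d" using u y by (auto simp: d intro: scaleR_nonneg_nonneg)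
  then show "inf d f = 0" by (intro disjoint_mono[OF n]) (use assms d in auto)
qed (use assms in auto)

lemma band_part_component: "inf (band_part y u) (u - band_part y u) = 0"
  using band_part_residue_disjoint band_part_le
  by (intro band_part_disjoint) (auto simp: inf_commute)

text \<open>The hull of \<open>{y}\<close> is the smallest band that contains \<open>y\<close>, and the disjoint complement of any
  element is a band; so everything disjoint from \<open>y\<close> is disjoint from the whole hull.\<close>

lemma band_projection_eq_band_part: "band_projection (band hull {y}) u = band_part y u"
proof -
  let ?B = "band hull {y}" and ?b = "band_part y u"
  have bandB: "band ?B"
    by (rule hull_in, rule band_Inter) blast
  have yB: "y \<in> ?B" by (simp add: hull_inc)
  have ideal: "c \<in> ?B" if "d \<in> ?B" "0 \<le> c" "c \<le> d" for c d
  proof -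
    have "\<bar>c\<bar> \<le> \<bar>d\<bar>" using that order_trans[OF that(2,3)] by simp
    then show ?thesis using bandB that(1) unfolding band_def riesz_ideal_def by blast
  qed
  have nB: "real n *\<^sub>R y \<in> ?B" for n :: nat
    using bandB yB by (simp add: band_def riesz_ideal_def subspace_def)
  have "inf u (real n *\<^sub>R y) \<in> ?B" for n :: nat
    by (rule ideal[OF nB[of n]]) (use u y in \<open>auto intro: scaleR_nonneg_nonneg\<close>)
  then have range: "range (\<lambda>n. inf u (real n *\<^sub>R y)) \<subseteq> ?B" by blast
  have "isLub UNIV (range (\<lambda>n. inf u (real n *\<^sub>R y))) ?b"
    unfolding isLub_def leastP_def isUb_def setle_def setge_def
    using band_part_upper by (auto simp: band_part_def intro!: cSUP_least)
  then have bB: "?b \<in> ?B" using bandB range unfolding band_def by blast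
  have "?B \<subseteq> {x. inf \<bar>x\<bar> (u - ?b) = 0}"
    using band_part_le band_part_residue_disjoint y
    by (intro hull_minimal) (auto simp: inf_commute band_disjoint_from)
  then have rB: "u - ?b \<in> disjoint_complement ?B"
    using band_part_le by (auto simp: disjoint_complement_def inf_commute)
  show ?thesis
    unfolding band_projection_def
  proof (rule the_equality)
    show "?b \<in> ?B \<and> u - ?b \<in> disjoint_complement ?B" using bB rB by simp
    fix b assume b: "b \<in> ?B \<and> u - b \<in> disjoint_complement ?B"
    have d: "b - ?b \<in> ?B"
      using b bB bandB by (auto simp: band_def riesz_ideal_def intro: subspace_diff)
    have "inf (\<bar>u - ?b\<bar> + \<bar>u - b\<bar>) \<bar>b - ?b\<bar> = 0"
      using b rB d by (intro disjoint_add) (auto simp: disjoint_complement_def)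
    moreover have "\<bar>b - ?b\<bar> \<le> \<bar>u - ?b\<bar> + \<bar>u - b\<bar>"
      using abs_triangle_ineq4[of "u - ?b" "u - b"] by simp
    ultimately have "inf \<bar>b - ?b\<bar> \<bar>b - ?b\<bar> = 0" by (elim disjoint_mono) auto
    then show "b = ?b" by simp
  qed
qed

end

text \<open>Chebyshev's inequality: \<open>band_part (pprt (u - c *\<^sub>R e)) e\<close> is the component \<open>r\<close> of \<open>e\<close> on
  which \<open>u > c e\<close>. It is disjoint from \<open>pprt (c *\<^sub>R e - u)\<close>, whereas \<open>pprt (c *\<^sub>R r - u)\<close> lies below both
  \<open>c *\<^sub>R r\<close> and that element.\<close>

lemma scaleR_level_component_le:
  fixes u e :: "'a::dedekind_complete_riesz_space"
  assumes "0 \<le> u" "0 \<le> e" "0 \<le> c"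
  shows "c *\<^sub>R band_part (pprt (u - c *\<^sub>R e)) e \<le> u"
proof -
  let ?r = "band_part (pprt (u - c *\<^sub>R e)) e"
  have r: "0 \<le> ?r" "?r \<le> e" using assms by (auto intro: band_part_nonneg band_part_le)
  define g where "g = pprt (c *\<^sub>R ?r - u)"
  have "inf (pprt (u - c *\<^sub>R e)) (pprt (c *\<^sub>R e - u)) = 0"
    using disjoint_pprts[of "u - c *\<^sub>R e"] by simp
  then have "inf ?r (pprt (c *\<^sub>R e - u)) = 0"
    using assms by (intro band_part_disjoint) auto
  then have "inf (c *\<^sub>R ?r) (pprt (c *\<^sub>R e - u)) = 0"
    using assms r by (intro disjoint_scaleR) auto
  moreover have "g \<le> c *\<^sub>R ?r"
    unfolding g_def
    by (subst pprt_def) (use assms(1,3) r(1) in \<open>auto intro: scaleR_nonneg_nonneg\<close>)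
  moreover have "g \<le> pprt (c *\<^sub>R e - u)"
    unfolding g_def using assms r by (intro pprt_mono diff_right_mono scaleR_left_mono)
  ultimately have "inf g g = 0" by (elim disjoint_mono) (auto simp: g_def)
  then show ?thesis by (simp add: g_def flip: le_zero_iff_zero_pprt)
qed

text \<open>Components of \<open>e\<close> play the role of indicator functions of events.\<close>

definition component :: "'a::riesz_space \<Rightarrow> 'a \<Rightarrow> bool" where
  "component e p \<longleftrightarrow> inf p (e - p) = 0"

lemma component_bounds:
  assumes "component e p"
  shows "0 \<le> p" "p \<le> e" "0 \<le> e"
proof -
  have "0 \<le> inf p (e - p)" using assms by (simp add: component_def)
  then show "0 \<le> p" "p \<le> e" by simp_all
  then show "0 \<le> e" by (rule order_trans)
qed

lemma component_disjoint: "component e p \<Longrightarrow> inf (e - p) p = 0"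
  by (simp add: component_def inf_commute)

lemma component_diff: "component e p \<Longrightarrow> component e (e - p)"
  by (simp add: component_def inf_commute)

lemma component_inf:
  assumes "component e p" "component e q"
  shows "component e (inf p q)"
proof -
  note bd = component_bounds[OF assms(1)] component_bounds[OF assms(2)]
  have "inf ((e - p) + (e - q)) (inf p q) = 0"
    using bd component_disjoint[OF assms(1)] component_disjoint[OF assms(2)]
    by (intro disjoint_add) (auto elim: disjoint_mono)
  moreover have "e - inf p q \<le> (e - p) + (e - q)"
  proof -
    have "p + q \<le> e + inf p q"
      using bd by (simp add: add_eq_inf_sup[of p q])
    then have "e + (p + q) \<le> e + (e + inf p q)" by (rule add_left_mono)
    then show ?thesis by (simp only: algebra_simps)
  qed
  ultimately have "inf (e - inf p q) (inf p q) = 0"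
    using bd by (elim disjoint_mono) (auto simp: le_infI1 simp del: diff_inf_eq_sup)
  then show ?thesis by (simp only: component_def inf_commute)
qed

lemma component_Sup:
  fixes e :: "'a::dedekind_complete_riesz_space"
  assumes "D \<noteq> {}" "\<And>d. d \<in> D \<Longrightarrow> component e d"
  shows "component e (Sup D)"
proof -
  have bd: "bdd_above D" using assms(2) by (intro bdd_aboveI[of _ e] component_bounds(2))
  have le: "Sup D \<le> e" using assms by (intro cSup_least component_bounds(2))
  have "inf (Sup D) (e - Sup D) = 0"
  proof (rule disjoint_Sup)
    fix d assume d: "d \<in> D"
    show "0 \<le> d" using assms(2)[OF d] by (rule component_bounds)
    have "d \<le> Sup D" using d bd by (rule cSup_upper)
    then have "inf (e - Sup D) d = 0"
      using le \<open>0 \<le> d\<close> by (intro disjoint_mono[OF component_disjoint[OF assms(2)[OF d]]]) auto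
    then show "inf d (e - Sup D) = 0" by (simp only: inf_commute)
  qed (use bd le assms(1) in auto)
  then show ?thesis by (simp add: component_def)
qed

lemma component_band_part:
  fixes e :: "'a::dedekind_complete_riesz_space"
  assumes "0 \<le> y" "0 \<le> e"
  shows "component e (band_part y e)"
  using assms by (simp only: component_def band_part_component)

lemma le_on_complement_level_component:
  fixes e :: "'a::dedekind_complete_riesz_space"
  assumes "0 \<le> e"
  shows "le_on (e - band_part (pprt (u - v)) e) u v"
  using band_part_residue_disjoint[of "pprt (u - v)" e] assms
  by (simp only: le_on_def inf_commute zero_le_pprt)

text \<open>In an Archimedean space this says that the positive elements \<open>p i\<close> together generate the whole space
  as a band. Disjointness is the form in which \<open>le_on\<close> can use it.\<close>

definition covers :: "'i set \<Rightarrow> ('i \<Rightarrow> 'a::riesz_space) \<Rightarrow> bool" where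
  "covers I p \<longleftrightarrow> (\<forall>f\<ge>0. (\<forall>i\<in>I. inf f (p i) = 0) \<longrightarrow> f = 0)"

lemma le_of_le_on_cover:
  assumes "covers I p" "\<And>i. i \<in> I \<Longrightarrow> le_on (p i) u v"
  shows "u \<le> v"
proof -
  have "pprt (u - v) = 0" using assms by (auto simp: covers_def le_on_def)
  then show ?thesis by (simp flip: le_zero_iff_zero_pprt)
qed

text \<open>Along a well-order of the index set, each component gives up what the earlier ones already
  took. Only suprema and differences are used, so the new components stay in any class \<open>C\<close>
  closed under these.\<close>

lemma disjoint_refinement:
  fixes e :: "'a::dedekind_complete_riesz_space" and a :: "'i \<Rightarrow> 'a"
  assumes comp: "\<And>p. p \<in> C \<Longrightarrow> component e p"
    and zero: "0 \<in> C"
    and Sup: "\<And>D. D \<subseteq> C \<Longrightarrow> D \<noteq> {} \<Longrightarrow> Sup D \<in> C"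
    and diff: "\<And>p q. p \<in> C \<Longrightarrow> q \<in> C \<Longrightarrow> inf p (e - q) \<in> C"
    and a: "\<And>i. i \<in> I \<Longrightarrow> a i \<in> C" and cov: "covers I a"
  obtains p where "\<And>i. i \<in> I \<Longrightarrow> p i \<in> C" "\<And>i. i \<in> I \<Longrightarrow> p i \<le> a i"
    "\<And>i k. i \<in> I \<Longrightarrow> k \<in> I \<Longrightarrow> i \<noteq> k \<Longrightarrow> inf (p i) (p k) = 0" "covers I p"
proof -
  obtain r :: "'i rel" where r: "well_order_on UNIV r" using well_order_on by blast
  then have wf: "wf (r - Id)" and tot: "total r"
    by (auto simp: well_order_on_def linear_order_on_def)
  define before where "before i = insert 0 (a ` {k \<in> I. (k, i) \<in> r - Id})" for i
  define p where "p i = inf (a i) (e - Sup (before i))" for i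
  have before: "before i \<subseteq> C" "before i \<noteq> {}" for i using a zero by (auto simp: before_def)
  then have SC: "Sup (before i) \<in> C" for i by (intro Sup)
  note bd = component_bounds[OF comp]
  have bdd: "bdd_above (before i)" for i
    using before(1)[of i] bd(2) by (intro bdd_aboveI[of _ e]) auto
  have pC: "p i \<in> C" if "i \<in> I" for i unfolding p_def using a[OF that] SC by (rule diff)
  have pa: "p i \<le> a i" for i by (simp add: p_def)
  have p0: "0 \<le> p i" if "i \<in> I" for i using pC[OF that] by (rule bd(1))
  have earlier: "inf (p k) (p i) = 0" if "i \<in> I" "k \<in> I" "(k, i) \<in> r - Id" for i k
  proof -
    have "a k \<le> Sup (before i)" using that bdd by (intro cSup_upper) (auto simp: before_def)
    with pa[of k] have pk: "p k \<le> Sup (before i)" by (rule order_trans)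
    have pi: "p i \<le> e - Sup (before i)" by (simp add: p_def)
    have "inf (p i) (p k) = 0"
      by (rule disjoint_mono[OF disjoint_mono[OF component_disjoint[OF comp[OF SC[of i]]] p0 pi]])
        (use p0 that bd(1)[OF SC] pk in auto)
    then show ?thesis by (simp only: inf_commute)
  qed
  have disj: "inf (p i) (p k) = 0" if "i \<in> I" "k \<in> I" "i \<noteq> k" for i k
  proof -
    have "(k, i) \<in> r - Id \<or> (i, k) \<in> r - Id" using tot that by (auto simp: total_on_def)
    then show ?thesis using earlier[of i k] earlier[of k i] that by (auto simp: inf_commute)
  qed
  have "covers I p"
    unfolding covers_def
  proof (intro allI impI)
    fix f :: 'a assume f: "0 \<le> f" "\<forall>i\<in>I. inf f (p i) = 0"
    have "i \<in> I \<longrightarrow> inf f (a i) = 0" for i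
    proof (induction i rule: wf_induct_rule[OF wf])
      case (1 i)
      show ?case
      proof
        assume i: "i \<in> I"
        have "inf (Sup (before i)) f = 0"
        proof (rule disjoint_Sup[OF bdd before(2)])
          fix d assume d: "d \<in> before i"
          then show "0 \<le> d" using before bd(1) by blast
          show "inf d f = 0"
            using d 1 f(1) by (auto simp: before_def inf_absorb1 inf_commute)
        qed (use f in auto)
        moreover have "inf (p i) f = 0" using f i by (simp add: inf_commute)
        ultimately have "inf (Sup (before i) + p i) f = 0"
          using bd(1)[OF SC] p0[OF i] f by (intro disjoint_add) auto
        moreover have "a i \<le> Sup (before i) + p i"
        proof -
          have "a i = inf (a i) (Sup (before i) + (e - Sup (before i)))"
            using bd(2)[OF a[OF i]] by (simp add: inf_absorb1)
          also have "\<dots> \<le> inf (a i) (Sup (before i)) + p i"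
            unfolding p_def using bd[OF a[OF i]] bd[OF SC] by (intro inf_add_le) auto
          also have "\<dots> \<le> Sup (before i) + p i" by (intro add_right_mono) simp
          finally show ?thesis .
        qed
        ultimately have "inf (a i) f = 0"
          using bd[OF a[OF i]] f by (elim disjoint_mono) auto
        then show "inf f (a i) = 0" by (simp only: inf_commute)
      qed
    qed
    then show "f = 0" using cov f(1) by (auto simp: covers_def)
  qed
  with pC pa disj show ?thesis by (intro that)
qed


section \<open>Mixing in universally complete Riesz spaces\<close>

text \<open>The parts of the \<open>u i\<close> in disjoint bands are pairwise disjoint, so lateral completeness provides
  their supremum.\<close>

lemma mixing_nonneg:
  fixes p u :: "'i \<Rightarrow> 'u::universally_complete_riesz_space"
  assumes p: "\<And>i. i \<in> I \<Longrightarrow> 0 \<le> p i"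
    and disj: "\<And>i k. i \<in> I \<Longrightarrow> k \<in> I \<Longrightarrow> i \<noteq> k \<Longrightarrow> inf (p i) (p k) = 0"
    and u: "\<And>i. i \<in> I \<Longrightarrow> 0 \<le> u i"
  shows "\<exists>z. \<forall>i\<in>I. inf \<bar>z - u i\<bar> (p i) = 0"
proof (cases "I = {}")
  case False
  define v where "v i = band_part (p i) (u i)" for i
  have v0: "0 \<le> v i" "v i \<le> u i" if "i \<in> I" for i
    using p u that by (auto simp: v_def band_part_nonneg band_part_le)
  have vp: "inf (v k) (p i) = 0" if "i \<in> I" "k \<in> I" "i \<noteq> k" for i k
    using that p u disj unfolding v_def by (intro band_part_disjoint) auto
  have vv: "inf (v i) (v k) = 0" if "i \<in> I" "k \<in> I" "i \<noteq> k" for i k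
    using that p u v0 vp[of i k]
    by (subst v_def, intro band_part_disjoint) (auto simp: inf_commute)
  have "pairwise (\<lambda>x y. inf x y = 0) (v ` I)"
    using vv by (auto simp: pairwise_def)
  then obtain s where ub: "\<And>i. i \<in> I \<Longrightarrow> v i \<le> s" and least: "\<And>w. (\<And>i. i \<in> I \<Longrightarrow> v i \<le> w) \<Longrightarrow> s \<le> w"
  proof -
    have "\<exists>s. (\<forall>x\<in>v ` I. x \<le> s) \<and> (\<forall>u. (\<forall>x\<in>v ` I. x \<le> u) \<longrightarrow> s \<le> u)"
      using \<open>pairwise _ _\<close> False v0(1) by (intro laterally_complete) auto
    then show ?thesis by (elim exE conjE, intro that) auto
  qed
  have "inf \<bar>s - u i\<bar> (p i) = 0" if i: "i \<in> I" for i
  proof -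
    define w where "w = inf (s - v i) (p i)"
    have w: "0 \<le> w" "w \<le> s - v i" "w \<le> p i" using ub[OF i] p[OF i] by (auto simp: w_def)
    have "w \<le> s" using w(2) v0(1)[OF i] by (meson diff_le_eq le_add_same_cancel1 order_trans)
    \<comment> \<open>Only \<open>v i\<close> lives on the band of \<open>p i\<close>, so \<open>s - w\<close> still bounds every \<open>v k\<close>.\<close>
    have "v k \<le> s - w" if k: "k \<in> I" for k
    proof (cases "k = i")
      case True
      then show ?thesis using w(2) by (simp add: algebra_simps)
    next
      case False
      then show ?thesis using vp[OF i k] w v0(1)[OF k] ub[OF k] \<open>w \<le> s\<close>
        by (intro disjoint_le_diff) (auto simp: inf_commute intro: disjoint_mono)
    qed
    then have "s \<le> s - w" by (rule least)
    then have "w \<le> 0" by simp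
    then have "w = 0" using w(1) by (rule antisym)
    then have "inf ((s - v i) + (u i - v i)) (p i) = 0"
      using ub v0 p u i band_part_residue_disjoint[of "p i" "u i"]
      by (intro disjoint_add) (auto simp: w_def v_def)
    moreover have "\<bar>s - u i\<bar> \<le> (s - v i) + (u i - v i)"
      using abs_triangle_ineq4[of "s - v i" "u i - v i"] ub v0 i by simp
    ultimately show ?thesis using p i by (elim disjoint_mono) auto
  qed
  then show ?thesis by blast
qed simp

text \<open>Positive and negative parts are mixed separately.\<close>

lemma mixing:
  fixes p u :: "'i \<Rightarrow> 'u::universally_complete_riesz_space"
  assumes p: "\<And>i. i \<in> I \<Longrightarrow> 0 \<le> p i"
    and disj: "\<And>i k. i \<in> I \<Longrightarrow> k \<in> I \<Longrightarrow> i \<noteq> k \<Longrightarrow> inf (p i) (p k) = 0"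
  obtains z where "\<And>i. i \<in> I \<Longrightarrow> inf \<bar>z - u i\<bar> (p i) = 0"
proof -
  obtain z where z: "\<forall>i\<in>I. inf \<bar>z - pprt (u i)\<bar> (p i) = 0"
    using mixing_nonneg[of I p "\<lambda>i. pprt (u i)"] p disj by auto
  obtain z' where z': "\<forall>i\<in>I. inf \<bar>z' - pprt (- u i)\<bar> (p i) = 0"
    using mixing_nonneg[of I p "\<lambda>i. pprt (- u i)"] p disj by auto
  have "inf \<bar>(z - z') - u i\<bar> (p i) = 0" if i: "i \<in> I" for i
  proof -
    have "u i = pprt (u i) - pprt (- u i)" using prts[of "u i"] by (simp add: pprt_neg)
    moreover have "(z - z') - (a - b) = (z - a) - (z' - b)" for a b by (simp add: algebra_simps)
    ultimately have "(z - z') - u i = (z - pprt (u i)) - (z' - pprt (- u i))" by metis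
    then have "\<bar>(z - z') - u i\<bar> \<le> \<bar>z - pprt (u i)\<bar> + \<bar>z' - pprt (- u i)\<bar>"
      by (simp only: abs_triangle_ineq4)
    moreover have "inf (\<bar>z - pprt (u i)\<bar> + \<bar>z' - pprt (- u i)\<bar>) (p i) = 0"
      using z z' i p by (intro disjoint_add) auto
    ultimately show ?thesis using p i by (elim disjoint_mono) auto
  qed
  then show ?thesis using that by blast
qed


section \<open>Order convergence to zero\<close>

definition eventual_bounds ::
    "'i set \<Rightarrow> ('i \<Rightarrow> 'i \<Rightarrow> bool) \<Rightarrow> ('i \<Rightarrow> 'a::riesz_space) \<Rightarrow> 'a set" where
  "eventual_bounds A le v = {y. \<exists>\<alpha>\<^sub>0\<in>A. \<forall>\<alpha>\<in>A. le \<alpha>\<^sub>0 \<alpha> \<longrightarrow> v \<alpha> \<le> y}"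

lemma eventual_bounds_transfer:
  assumes "y \<in> eventual_bounds A le v" "\<And>\<alpha>. \<alpha> \<in> A \<Longrightarrow> v \<alpha> \<le> y \<Longrightarrow> v' \<alpha> \<le> y'"
  shows "y' \<in> eventual_bounds A le v'"
  using assms unfolding eventual_bounds_def by blast

lemma order_convergent_0D:
  fixes v :: "'i \<Rightarrow> 'a::riesz_space"
  assumes v: "\<And>\<alpha>. \<alpha> \<in> A \<Longrightarrow> 0 \<le> v \<alpha>" and oc: "order_convergent A le v 0"
    and w: "\<And>y. y \<in> eventual_bounds A le v \<Longrightarrow> w \<le> y"
  shows "w \<le> 0"
proof -
  obtain \<Gamma> :: "'a set" and le' y where y: "decreases_to_zero \<Gamma> le' y"
    and dom: "\<forall>\<gamma>\<in>\<Gamma>. \<exists>\<alpha>\<^sub>0\<in>A. \<forall>\<alpha>\<in>A. le \<alpha>\<^sub>0 \<alpha> \<longrightarrow> \<bar>v \<alpha> - 0\<bar> \<le> y \<gamma>"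
    using oc unfolding order_convergent_def by blast
  have "y \<gamma> \<in> eventual_bounds A le v" if "\<gamma> \<in> \<Gamma>" for \<gamma>
    using dom that v by (fastforce simp: eventual_bounds_def)
  then have "w \<le> y \<gamma>" if "\<gamma> \<in> \<Gamma>" for \<gamma> using w that by blast
  then show "w \<le> 0"
    using y by (auto simp: decreases_to_zero_def isGlb_def greatestP_def isLb_def setle_def setge_def)
qed

text \<open>The eventual upper bounds of a positive net are directed downwards, so they can serve as the
  dominating net themselves.\<close>

lemma order_convergent_0I:
  fixes v :: "'i \<Rightarrow> 'a::riesz_space"
  assumes dir: "directed_set A le" and v: "\<And>\<alpha>. \<alpha> \<in> A \<Longrightarrow> 0 \<le> v \<alpha>"
    and glb: "\<And>w. (\<And>y. y \<in> eventual_bounds A le v \<Longrightarrow> w \<le> y) \<Longrightarrow> w \<le> 0"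
  shows "order_convergent A le v 0"
proof -
  let ?U = "eventual_bounds A le v"
  have pos: "0 \<le> y" if y: "y \<in> ?U" for y
  proof -
    obtain \<alpha>\<^sub>0 where a: "\<alpha>\<^sub>0 \<in> A" "\<forall>\<alpha>\<in>A. le \<alpha>\<^sub>0 \<alpha> \<longrightarrow> v \<alpha> \<le> y"
      using y by (auto simp: eventual_bounds_def)
    then have "v \<alpha>\<^sub>0 \<le> y" using dir by (auto simp: directed_set_def reflp_on_def)
    then show ?thesis using v[OF a(1)] by (rule order_trans[rotated])
  qed
  have inf: "inf y z \<in> ?U" if yz: "y \<in> ?U" "z \<in> ?U" for y z
  proof -
    obtain \<alpha> where a: "\<alpha> \<in> A" "\<forall>\<gamma>\<in>A. le \<alpha> \<gamma> \<longrightarrow> v \<gamma> \<le> y" using yz by (auto simp: eventual_bounds_def)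
    obtain \<beta> where b: "\<beta> \<in> A" "\<forall>\<gamma>\<in>A. le \<beta> \<gamma> \<longrightarrow> v \<gamma> \<le> z" using yz by (auto simp: eventual_bounds_def)
    obtain \<gamma> where c: "\<gamma> \<in> A" "le \<alpha> \<gamma>" "le \<beta> \<gamma>" using dir a b unfolding directed_set_def by blast
    have "le \<alpha> \<delta>" "le \<beta> \<delta>" if "\<delta> \<in> A" "le \<gamma> \<delta>" for \<delta>
      using dir a b c that unfolding directed_set_def transp_on_def by blast+
    then show ?thesis using a b c(1) unfolding eventual_bounds_def mem_Collect_eq
      by (intro bexI[of _ \<gamma>]) auto
  qed
  have ne: "?U \<noteq> {}"
  proof
    assume empty: "?U = {}"
    obtain \<alpha>\<^sub>0 where "\<alpha>\<^sub>0 \<in> A" using dir by (auto simp: directed_set_def)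
    moreover have "v \<alpha> \<le> 0" for \<alpha> using glb empty by auto
    ultimately have "0 \<in> ?U" by (auto simp: eventual_bounds_def)
    with empty show False by simp
  qed
  have "decreases_to_zero ?U (\<ge>) (\<lambda>y. y)"
    unfolding decreases_to_zero_def directed_set_def
  proof (intro conjI ballI)
    show "\<exists>c\<in>?U. a \<ge> c \<and> b \<ge> c" if "a \<in> ?U" "b \<in> ?U" for a b
      using inf[OF that] by (intro bexI[of _ "inf a b"]) auto
    show "isGlb UNIV ((\<lambda>y. y) ` ?U) 0"
      using pos glb by (auto simp: isGlb_def greatestP_def isLb_def setle_def setge_def)
  qed (use ne in \<open>auto simp: reflp_on_def transp_on_def monotone_on_def\<close>)
  then show ?thesis
  proof (rule order_convergentI)
    fix y assume "y \<in> ?U"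
    then show "\<exists>\<alpha>\<^sub>0\<in>A. \<forall>\<alpha>\<in>A. le \<alpha>\<^sub>0 \<alpha> \<longrightarrow> \<bar>v \<alpha> - 0\<bar> \<le> y"
      using v by (fastforce simp: eventual_bounds_def)
  qed
qed

section \<open>A vector-valued metric for convergence in conditional probability\<close>

locale cond_triple =
  fixes e :: "'a::dedekind_complete_riesz_space"
    and T :: "'a \<Rightarrow> 'a"
    and j :: "'a \<Rightarrow> 'u::universally_complete_riesz_space"
  assumes triple: "conditional_riesz_triple e T"
    and completion: "universal_completion j"
begin

lemma linear_j: "linear j" and inj_j: "inj j"
  and j_sup: "j (sup x y) = sup (j x) (j y)"
  and j_dense: "0 < u \<Longrightarrow> \<exists>x. 0 < j x \<and> j x \<le> u"
  using completion by (auto simp: universal_completion_def)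

lemma j_le_iff: "j x \<le> j y \<longleftrightarrow> x \<le> y"
  by (metis j_sup inj_j injD le_iff_sup)

lemma j_0 [simp]: "j 0 = 0"
  using linear_j by (rule linear_0)

lemma j_nonneg_iff [simp]: "0 \<le> j x \<longleftrightarrow> 0 \<le> x"
  using j_le_iff[of 0 x] by simp

lemma j_eq_0_iff [simp]: "j x = 0 \<longleftrightarrow> x = 0"
  using inj_j by (metis j_0 injD)

lemmas j_add = linear_add[OF linear_j]
  and j_scaleR = linear_scale[OF linear_j]

lemma j_inf: "j (inf x y) = inf (j x) (j y)"
  by (simp add: inf_eq_neg_sup j_sup linear_neg[OF linear_j] del: neg_sup_eq_inf)

lemma e_nonneg [simp]: "0 \<le> e" and weak_unit: "inf \<bar>x\<bar> e = 0 \<Longrightarrow> x = 0"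
  using triple by (auto simp: conditional_riesz_triple_def weak_order_unit_def)

lemma T_positive: "positive_operator T" and T_order_continuous: "order_continuous T"
  and T_idem: "T (T x) = T x" and T_subspace: "riesz_subspace (range T)" and T_e [simp]: "T e = e"
  and T_strict: "T \<bar>x\<bar> = 0 \<longleftrightarrow> x = 0"
  using triple by (auto simp: conditional_riesz_triple_def conditional_expectation_def)

lemma linear_T: "linear T"
  using T_positive by (simp add: positive_operator_def)

lemmas T_mono = positive_operator_mono[OF T_positive]
  and T_diff = linear_diff[OF linear_T] and T_add = linear_add[OF linear_T]
  and T_scaleR = linear_scale[OF linear_T] and T_0 [simp] = linear_0[OF linear_T]

lemma range_T_iff: "x \<in> range T \<longleftrightarrow> T x = x"
  by (metis T_idem rangeE rangeI)

lemma range_T_closed: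
  assumes "T x = x" "T y = y"
  shows "T (x + y) = x + y" "T (x - y) = x - y" "T (c *\<^sub>R x) = c *\<^sub>R x"
    "T (sup x y) = sup x y" "T (inf x y) = inf x y"
proof -
  show "T (x + y) = x + y" "T (x - y) = x - y" "T (c *\<^sub>R x) = c *\<^sub>R x"
    using assms by (simp_all add: T_add T_diff T_scaleR)
  have "x \<in> range T" "y \<in> range T" using assms by (simp_all only: range_T_iff)
  then show "T (sup x y) = sup x y" "T (inf x y) = inf x y"
    using T_subspace unfolding riesz_subspace_def range_T_iff[symmetric] by blast+
qed

text \<open>Strict positivity alone makes the range closed under suprema: for a supremum \<open>s\<close> of fixed
  points, \<open>T s - s\<close> is positive and is annihilated by \<open>T\<close>.\<close>

lemma T_Sup:
  assumes "D \<noteq> {}" "bdd_above D" "\<And>d. d \<in> D \<Longrightarrow> T d = d"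
  shows "T (Sup D) = Sup D"
proof -
  have "Sup D \<le> T (Sup D)"
  proof (rule cSup_least[OF assms(1)])
    fix d assume d: "d \<in> D"
    then have "T d \<le> T (Sup D)" using assms(2) by (intro T_mono cSup_upper)
    then show "d \<le> T (Sup D)" using assms(3)[OF d] by simp
  qed
  then have "T \<bar>T (Sup D) - Sup D\<bar> = 0" by (simp add: T_diff T_idem)
  then show ?thesis by (simp only: T_strict right_minus_eq)
qed

lemma weak_unit_j:
  assumes "0 \<le> f" "inf f (j e) = 0"
  shows "f = 0"
proof (rule ccontr)
  assume "f \<noteq> 0"
  then obtain a where a: "0 < j a" "j a \<le> f" using j_dense[of f] assms(1) by (auto simp: less_le)
  then have "0 \<le> j a" "j a \<noteq> 0" by (auto simp: less_le)
  then have "0 \<le> a" "a \<noteq> 0" by simp_all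
  have "inf (j a) (j e) = 0" using assms(2) a \<open>0 \<le> a\<close> by (elim disjoint_mono) auto
  then have "inf \<bar>a\<bar> e = 0" using \<open>0 \<le> a\<close> by (simp flip: j_inf)
  then show False using weak_unit \<open>a \<noteq> 0\<close> by blast
qed

definition truncate :: "'u \<Rightarrow> 'a" where
  "truncate u = inv j (inf u (j e))"

lemma j_truncate:
  assumes "0 \<le> u"
  shows "j (truncate u) = inf u (j e)"
proof -
  have "\<bar>inf u (j e)\<bar> \<le> \<bar>j e\<bar>" using assms by simp
  then have "inf u (j e) \<in> range j"
    using universal_completion_ideal[OF completion] unfolding riesz_ideal_def by blast
  then show ?thesis unfolding truncate_def by (rule f_inv_into_f)
qed

lemma truncate_le_iff: "0 \<le> u \<Longrightarrow> truncate u \<le> x \<longleftrightarrow> inf u (j e) \<le> j x"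
  by (simp flip: j_truncate add: j_le_iff)

lemma truncate_nonneg: "0 \<le> u \<Longrightarrow> 0 \<le> truncate u"
  unfolding j_nonneg_iff[symmetric] by (simp add: j_truncate)

lemma truncate_le_e: "0 \<le> u \<Longrightarrow> truncate u \<le> e"
  by (simp add: truncate_le_iff)

lemma truncate_mono: "0 \<le> u \<Longrightarrow> u \<le> v \<Longrightarrow> truncate u \<le> truncate v"
  by (simp add: truncate_le_iff j_truncate[of v] order_trans[of 0 u v] le_infI1)

text \<open>The vector-valued analogue of the seminorm \<open>\<integral> min \<bar>f\<bar> 1\<close> that metrises convergence in probability.\<close>

definition rho :: "'u \<Rightarrow> 'a" where
  "rho u = T (truncate u)"

lemma T_rho: "T (rho u) = rho u"
  by (simp add: rho_def T_idem)

lemma rho_mono: "0 \<le> u \<Longrightarrow> u \<le> v \<Longrightarrow> rho u \<le> rho v"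
  unfolding rho_def by (intro T_mono truncate_mono)

lemma rho_nonneg: "0 \<le> u \<Longrightarrow> 0 \<le> rho u"
  unfolding rho_def using T_mono[OF truncate_nonneg] by simp

lemma rho_le_e: "0 \<le> u \<Longrightarrow> rho u \<le> e"
  unfolding rho_def using T_mono[OF truncate_le_e] by simp

lemma rho_j: "0 \<le> x \<Longrightarrow> rho (j x) \<le> T x"
  unfolding rho_def by (intro T_mono) (simp add: truncate_le_iff)

lemma rho_add:
  assumes "0 \<le> u" "0 \<le> v"
  shows "rho (u + v) \<le> rho u + rho v"
proof -
  have "truncate (u + v) \<le> truncate u + truncate v"
    using assms inf_add_le[of "j e" u v]
    by (simp add: truncate_le_iff j_add j_truncate inf_commute)
  then show ?thesis unfolding rho_def T_add[symmetric] by (rule T_mono)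
qed

lemma rho_sum:
  assumes "\<And>k. k \<in> K \<Longrightarrow> 0 \<le> f k"
  shows "rho (sum f K) \<le> (\<Sum>k\<in>K. rho (f k))"
  using assms
proof (induction K rule: infinite_finite_induct)
  case (insert k K)
  then have "rho (f k + sum f K) \<le> rho (f k) + rho (sum f K)" by (intro rho_add sum_nonneg) auto
  also have "\<dots> \<le> rho (f k) + (\<Sum>k\<in>K. rho (f k))" using insert by (intro add_left_mono) auto
  finally show ?case using insert by simp
qed (use rho_j[of 0] in auto)

lemma rho_scaleR:
  assumes "0 \<le> u" "1 \<le> c"
  shows "rho (c *\<^sub>R u) \<le> c *\<^sub>R rho u"
proof -
  have "(1 / c) *\<^sub>R j e \<le> 1 *\<^sub>R j e" using assms by (intro scaleR_right_mono) auto
  moreover have "(1 / c) *\<^sub>R inf (c *\<^sub>R u) (j e) \<le> (1 / c) *\<^sub>R (c *\<^sub>R u)"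
    "(1 / c) *\<^sub>R inf (c *\<^sub>R u) (j e) \<le> (1 / c) *\<^sub>R j e"
    using assms by (auto intro!: scaleR_left_mono simp del: scaleR_scaleR)
  ultimately have "(1 / c) *\<^sub>R inf (c *\<^sub>R u) (j e) \<le> inf u (j e)"
    using assms by auto
  then have "c *\<^sub>R ((1 / c) *\<^sub>R inf (c *\<^sub>R u) (j e)) \<le> c *\<^sub>R inf u (j e)"
    using assms by (intro scaleR_left_mono) auto
  then have "truncate (c *\<^sub>R u) \<le> c *\<^sub>R truncate u"
    using assms by (simp add: truncate_le_iff j_scaleR j_truncate scaleR_nonneg_nonneg)
  then show ?thesis unfolding rho_def T_scaleR[symmetric] by (rule T_mono)
qed

lemma rho_eq_0:
  assumes "0 \<le> u" "rho u = 0"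
  shows "u = 0"
proof -
  have "truncate u = 0"
    using assms T_strict[of "truncate u"] truncate_nonneg[of u] by (simp add: rho_def)
  then show ?thesis using j_truncate[OF assms(1)] weak_unit_j[OF assms(1)] by simp
qed

text \<open>If \<open>u\<close> is disjoint from the \<open>T\<close>-invariant component \<open>p\<close>, its truncation lies below \<open>e - p\<close>,
  and positivity of \<open>T\<close> carries that bound over; so \<open>rho\<close> is local on \<open>T\<close>-invariant components.\<close>

lemma rho_disjoint:
  assumes p: "component e p" "T p = p" and u: "0 \<le> u" "inf u (j p) = 0"
  shows "inf (rho u) p = 0"
proof -
  have "j (inf (truncate u) p) = inf (inf u (j e)) (j p)" by (simp add: j_inf j_truncate u)
  also have "\<dots> = 0"
    using u component_bounds[OF p(1)] by (intro disjoint_mono[OF u(2)]) auto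
  finally have "truncate u \<le> e - p"
    using u component_bounds[OF p(1)] by (intro disjoint_le_diff) (auto simp: truncate_le_e)
  then have "rho u \<le> e - p" unfolding rho_def using T_mono p(2) by (metis T_diff T_e)
  then show ?thesis
    using component_bounds[OF p(1)] u
    by (intro disjoint_mono[OF component_disjoint[OF p(1)]]) (auto simp: rho_nonneg)
qed

text \<open>The component \<open>r\<close> of \<open>e\<close> on which \<open>u = \<bar>x \<alpha> - l\<bar>\<close> exceeds \<open>\<epsilon> e\<close> satisfies \<open>\<epsilon> r \<le> u\<close>, and conversely
  \<open>inf u e \<le> \<epsilon> e + r\<close>; so the two quantities control each other up to a small error.\<close>

lemma converges_in_cond_prob_iff_rho:
  assumes dir: "directed_set A le"
  shows "converges_in_cond_prob j e T A le x l \<longleftrightarrow>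
    order_convergent A le (\<lambda>\<alpha>. rho \<bar>x \<alpha> - l\<bar>) 0"
proof -
  define r where "r \<epsilon> u = band_part (pprt (u - \<epsilon> *\<^sub>R j e)) (j e)" for \<epsilon> u
  have r: "0 \<le> r \<epsilon> u" "r \<epsilon> u \<le> j e" for \<epsilon> u
    by (auto simp: r_def band_part_nonneg band_part_le)
  have Tr: "T (inv j (band_projection (band hull {pprt (u - \<epsilon> *\<^sub>R j e)}) (j e))) = rho (r \<epsilon> u)"
    for \<epsilon> u
    using r by (simp add: band_projection_eq_band_part rho_def truncate_def r_def inf_absorb1)
  have upper: "rho u \<le> \<epsilon> *\<^sub>R e + rho (r \<epsilon> u)" if "0 \<le> u" "0 < \<epsilon>" for u \<epsilon>
  proof -
    have "u \<le> \<epsilon> *\<^sub>R j e + pprt (u - \<epsilon> *\<^sub>R j e)"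
      by (simp add: pprt_def add_sup_distrib_left)
    then have "rho u \<le> rho (j (\<epsilon> *\<^sub>R e) + pprt (u - \<epsilon> *\<^sub>R j e))"
      using that by (intro rho_mono) (auto simp: j_scaleR)
    also have "\<dots> \<le> rho (j (\<epsilon> *\<^sub>R e)) + rho (pprt (u - \<epsilon> *\<^sub>R j e))"
      using that by (intro rho_add) (auto simp: scaleR_nonneg_nonneg)
    also have "\<dots> \<le> \<epsilon> *\<^sub>R e + rho (r \<epsilon> u)"
    proof (intro add_mono)
      show "rho (j (\<epsilon> *\<^sub>R e)) \<le> \<epsilon> *\<^sub>R e"
        using rho_j[of "\<epsilon> *\<^sub>R e"] that by (simp add: T_scaleR scaleR_nonneg_nonneg)
      have "inf (j e) (pprt (u - \<epsilon> *\<^sub>R j e)) \<le> r \<epsilon> u"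
        unfolding r_def by (rule inf_le_band_part) auto
      then show "rho (pprt (u - \<epsilon> *\<^sub>R j e)) \<le> rho (r \<epsilon> u)"
        unfolding rho_def using r by (intro T_mono) (simp add: truncate_le_iff j_truncate inf_commute)
    qed
    finally show ?thesis .
  qed
  have lower: "rho (r \<epsilon> u) \<le> real N *\<^sub>R rho u" if "0 \<le> u" "0 < \<epsilon>" "1 \<le> N" "1 / \<epsilon> \<le> real N"
    for u \<epsilon> N
  proof -
    have "(1 / \<epsilon>) *\<^sub>R (\<epsilon> *\<^sub>R r \<epsilon> u) \<le> (1 / \<epsilon>) *\<^sub>R u"
      using that unfolding r_def by (intro scaleR_left_mono scaleR_level_component_le) auto
    moreover have "(1 / \<epsilon>) *\<^sub>R u \<le> real N *\<^sub>R u" using that by (intro scaleR_right_mono)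
    ultimately have "r \<epsilon> u \<le> real N *\<^sub>R u" using that by simp
    then have "rho (r \<epsilon> u) \<le> rho (real N *\<^sub>R u)" using r by (intro rho_mono)
    also have "\<dots> \<le> real N *\<^sub>R rho u" using that by (intro rho_scaleR) auto
    finally show ?thesis .
  qed
  have "order_convergent A le (\<lambda>\<alpha>. rho \<bar>x \<alpha> - l\<bar>) 0"
    if conv: "\<And>\<epsilon>. 0 < \<epsilon> \<Longrightarrow> order_convergent A le (\<lambda>\<alpha>. rho (r \<epsilon> \<bar>x \<alpha> - l\<bar>)) 0"
  proof (rule order_convergent_0I[OF dir])
    fix w assume w: "\<And>y. y \<in> eventual_bounds A le (\<lambda>\<alpha>. rho \<bar>x \<alpha> - l\<bar>) \<Longrightarrow> w \<le> y"
    show "w \<le> 0"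
    proof (rule le_zero_of_le_scaleR)
      fix \<epsilon> :: real assume \<epsilon>: "0 < \<epsilon>"
      have "w - \<epsilon> *\<^sub>R e \<le> y" if "y \<in> eventual_bounds A le (\<lambda>\<alpha>. rho (r \<epsilon> \<bar>x \<alpha> - l\<bar>))" for y
      proof -
        have "\<epsilon> *\<^sub>R e + y \<in> eventual_bounds A le (\<lambda>\<alpha>. rho \<bar>x \<alpha> - l\<bar>)"
          using that upper[OF abs_ge_zero \<epsilon>]
          by (elim eventual_bounds_transfer) (meson add_left_mono order_trans)
        then have "w \<le> \<epsilon> *\<^sub>R e + y" using w by blast
        then show ?thesis by (simp add: algebra_simps)
      qed
      then have "w - \<epsilon> *\<^sub>R e \<le> 0"
        by (rule order_convergent_0D[OF _ conv[OF \<epsilon>], rotated]) (auto intro: rho_nonneg r)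
      then show "w \<le> \<epsilon> *\<^sub>R e" by simp
    qed
  qed (simp add: rho_nonneg)
  moreover have "order_convergent A le (\<lambda>\<alpha>. rho (r \<epsilon> \<bar>x \<alpha> - l\<bar>)) 0"
    if conv: "order_convergent A le (\<lambda>\<alpha>. rho \<bar>x \<alpha> - l\<bar>) 0" and \<epsilon>: "0 < \<epsilon>" for \<epsilon>
  proof (rule order_convergent_0I[OF dir])
    fix w assume w: "\<And>y. y \<in> eventual_bounds A le (\<lambda>\<alpha>. rho (r \<epsilon> \<bar>x \<alpha> - l\<bar>)) \<Longrightarrow> w \<le> y"
    obtain N0 :: nat where N0: "1 / \<epsilon> \<le> real N0" using real_arch_simple by blast
    define N where "N = Suc N0"
    have N: "1 \<le> N" "1 / \<epsilon> \<le> real N" using N0 by (auto simp: N_def)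
    have "(1 / real N) *\<^sub>R w \<le> y" if y: "y \<in> eventual_bounds A le (\<lambda>\<alpha>. rho \<bar>x \<alpha> - l\<bar>)" for y
    proof -
      have "real N *\<^sub>R y \<in> eventual_bounds A le (\<lambda>\<alpha>. rho (r \<epsilon> \<bar>x \<alpha> - l\<bar>))"
        using y lower[OF abs_ge_zero \<epsilon> N]
        by (elim eventual_bounds_transfer) (meson of_nat_0_le_iff scaleR_left_mono order_trans)
      then have "(1 / real N) *\<^sub>R w \<le> (1 / real N) *\<^sub>R (real N *\<^sub>R y)"
        using w by (intro scaleR_left_mono) auto
      then show ?thesis using N by simp
    qed
    then have "(1 / real N) *\<^sub>R w \<le> 0"
      by (rule order_convergent_0D[OF _ conv, rotated]) (auto intro: rho_nonneg)
    then have "real N *\<^sub>R ((1 / real N) *\<^sub>R w) \<le> real N *\<^sub>R 0" by (intro scaleR_left_mono) auto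
    then show "w \<le> 0" using N by simp
  qed (simp add: rho_nonneg r)
  ultimately show ?thesis unfolding converges_in_cond_prob_def Tr by blast
qed

text \<open>Monotone convergence for \<open>rho\<close>. This is where order continuity of \<open>T\<close> enters.\<close>

lemma rho_lub_le:
  fixes t :: "nat \<Rightarrow> 'u"
  assumes inc: "incseq t" and nonneg: "\<And>m. 0 \<le> t m" and ub: "\<And>m. t m \<le> v"
    and least: "\<And>u. (\<And>m. t m \<le> u) \<Longrightarrow> v \<le> u" and w: "\<And>m. rho (t m) \<le> w"
  shows "rho v \<le> w"
proof -
  have v0: "0 \<le> v" using nonneg ub order_trans by blast
  define h where "h m = truncate (t m)" for m
  define H where "H = (SUP m. h m)"
  have bdd: "bdd_above (range h)"
    using nonneg truncate_le_e by (auto simp: h_def intro!: bdd_aboveI[of _ e])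
  have hH: "h m \<le> H" for m unfolding H_def using bdd by (intro cSUP_upper) auto
  have hinc: "h m \<le> h n" if "m \<le> n" for m n
    unfolding h_def using inc that nonneg by (intro truncate_mono) (auto simp: incseq_def)
  \<comment> \<open>This decomposition turns the bound on the truncations of the \<open>t m\<close> into one on that of \<open>v\<close>.\<close>
  have split: "u = inf u (j e) + sup u (j e) - j e" for u
    using add_eq_inf_sup[of u "j e"] by (simp add: algebra_simps)
  have "t m \<le> j H + sup v (j e) - j e" for m
  proof -
    have "inf (t m) (j e) \<le> j H"
      using hH[of m] nonneg[of m] by (simp add: h_def truncate_le_iff)
    moreover have "sup (t m) (j e) \<le> sup v (j e)" using ub by (intro sup_mono) auto
    ultimately show ?thesis by (subst split) (intro diff_right_mono add_mono)
  qed
  then have "v \<le> j H + sup v (j e) - j e" by (rule least)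
  then have "inf v (j e) \<le> j H"
    using split[of v] by (metis add_le_cancel_right diff_le_eq diff_add_cancel)
  then have "rho v \<le> T H" unfolding rho_def using v0 by (intro T_mono) (simp add: truncate_le_iff)
  have dir: "directed_set (UNIV :: nat set) (\<le>)"
    by (auto simp: directed_set_def reflp_on_def transp_on_def intro: max.cobounded1 max.cobounded2)
  have "order_convergent UNIV (\<le>) (\<lambda>m. H - h m) 0"
  proof (rule order_convergent_0I[OF dir])
    fix z assume z: "\<And>y. y \<in> eventual_bounds UNIV (\<le>) (\<lambda>m. H - h m) \<Longrightarrow> z \<le> y"
    have "h m \<le> H - z" for m
    proof -
      have "H - h m \<in> eventual_bounds UNIV (\<le>) (\<lambda>m. H - h m)"
        using hinc by (auto simp: eventual_bounds_def intro!: exI[of _ m])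
      then have "z \<le> H - h m" using z by blast
      then show ?thesis by (simp add: algebra_simps)
    qed
    then have "H \<le> H - z" unfolding H_def by (intro cSUP_least) auto
    then show "z \<le> 0" by simp
  qed (simp add: hH)
  then have conv: "order_convergent UNIV (\<le>) (\<lambda>m. T (H - h m)) (T 0)"
    by (rule positive_order_continuous[OF T_positive T_order_continuous])
  have nonneg_T: "0 \<le> T (H - h m)" for m using T_mono[of 0 "H - h m"] hH by simp
  have "T H - w \<le> y" if y: "y \<in> eventual_bounds UNIV (\<le>) (\<lambda>m. T (H - h m))" for y
  proof -
    obtain m where "T (H - h m) \<le> y" using y by (auto simp: eventual_bounds_def)
    moreover have "T (h m) \<le> w" using w[of m] by (simp add: h_def rho_def)
    then have "T H - w \<le> T H - T (h m)" by (rule diff_left_mono)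
    ultimately show ?thesis unfolding T_diff by (rule order_trans[rotated])
  qed
  then have "T H - w \<le> 0"
    using conv nonneg_T by (intro order_convergent_0D[of UNIV "\<lambda>m. T (H - h m)" "(\<le>)"]) auto
  with \<open>rho v \<le> T H\<close> show ?thesis by (simp add: order_trans)
qed

end

section \<open>Sequential completeness\<close>

lemma geometric_sum_le:
  fixes b :: real
  assumes "0 \<le> b" "b \<le> 1 / 2"
  shows "(\<Sum>k<m. b ^ (n + k)) \<le> 2 * b ^ n"
proof -
  have "(\<Sum>k<m. b ^ (n + k)) \<le> 2 * b ^ n - 2 * b ^ (n + m)"
  proof (induction m)
    case (Suc m)
    have "b * b ^ (n + m) \<le> (1 / 2) * b ^ (n + m)" using assms by (intro mult_right_mono) auto
    then show ?case using Suc by simp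
  qed simp
  also have "\<dots> \<le> 2 * b ^ n" using assms by simp
  finally show ?thesis .
qed

context cond_triple
begin

lemma rho_triangle: "rho \<bar>u - w\<bar> \<le> rho \<bar>u - v\<bar> + rho \<bar>v - w\<bar>"
proof -
  have "\<bar>u - w\<bar> \<le> \<bar>u - v\<bar> + \<bar>v - w\<bar>" using abs_triangle_ineq[of "u - v" "v - w"] by simp
  then have "rho \<bar>u - w\<bar> \<le> rho (\<bar>u - v\<bar> + \<bar>v - w\<bar>)" by (intro rho_mono) auto
  also have "\<dots> \<le> rho \<bar>u - v\<bar> + rho \<bar>v - w\<bar>" by (intro rho_add) auto
  finally show ?thesis .
qed

lemma rho_le_null_sequence:
  assumes "0 \<le> f" and "\<And>n. rho f \<le> (2 * (1 / 2) ^ n) *\<^sub>R e"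
  shows "f = 0"
proof -
  have "rho f \<le> 0"
  proof (rule le_zero_of_le_scaleR)
    fix c :: real assume "0 < c"
    then obtain n where "(1 / 2) ^ n < c / 2" using real_arch_pow_inv[of "c / 2" "1 / 2"] by auto
    then have "(2 * (1 / 2) ^ n) *\<^sub>R e \<le> c *\<^sub>R e" by (intro scaleR_right_mono) auto
    with assms(2)[of n] show "rho f \<le> c *\<^sub>R e" by (rule order_trans)
  qed
  then have "rho f = 0" using rho_nonneg[OF assms(1)] by (rule antisym)
  then show ?thesis by (rule rho_eq_0[OF assms(1)])
qed

text \<open>Borel--Cantelli: outside components \<open>G n\<close> with \<open>rho (G n) \<rightarrow> 0\<close> the increments satisfy
  \<open>d k \<le> (1/2)^k e\<close> for \<open>k \<ge> n\<close>, so there the series is bounded by its \<open>n\<close>-th partial sum plus \<open>2 e\<close>.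
  Mixing these local bounds gives a global one.\<close>

lemma summable_bounded:
  fixes d :: "nat \<Rightarrow> 'u"
  assumes d0: "\<And>k. 0 \<le> d k" and d: "\<And>k. rho (d k) \<le> ((1 / 4) ^ k) *\<^sub>R e"
  obtains w where "\<And>m. (\<Sum>k<m. d k) \<le> w"
proof -
  define s where "s m = (\<Sum>k<m. d k)" for m
  define r where "r k = band_part (pprt (d k - ((1 / 2) ^ k) *\<^sub>R j e)) (j e)" for k
  define G where "G n = (SUP k. r (n + k))" for n
  have r_comp: "component (j e) (r k)" for k unfolding r_def by (rule component_band_part) auto
  note r_bounds = component_bounds[OF r_comp]
  \<comment> \<open>Chebyshev at the threshold \<open>(1/2)^k\<close> costs a factor \<open>2^k\<close>, which the rate \<open>(1/4)^k\<close> can afford.\<close>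
  have rho_r: "rho (r k) \<le> ((1 / 2) ^ k) *\<^sub>R e" for k
  proof -
    have "(2 ^ k) *\<^sub>R (((1 / 2) ^ k) *\<^sub>R r k) \<le> (2 ^ k) *\<^sub>R d k"
      unfolding r_def using d0 by (intro scaleR_left_mono scaleR_level_component_le) auto
    then have "r k \<le> (2 ^ k) *\<^sub>R d k" by (simp add: power_one_over)
    then have "rho (r k) \<le> rho ((2 ^ k) *\<^sub>R d k)" using r_bounds by (intro rho_mono)
    also have "\<dots> \<le> (2 ^ k) *\<^sub>R rho (d k)" using d0 by (intro rho_scaleR) auto
    also have "\<dots> \<le> (2 ^ k) *\<^sub>R (((1 / 4) ^ k) *\<^sub>R e)" using d by (intro scaleR_left_mono) auto
    also have "\<dots> = ((1 / 2) ^ k) *\<^sub>R e" by (simp flip: power_mult_distrib)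
    finally show ?thesis .
  qed
  have r_bdd: "bdd_above ((\<lambda>k. r (n + k)) ` K)" for n K
    using r_bounds(2) by (auto intro!: bdd_aboveI[of _ "j e"])
  have G_comp: "component (j e) (G n)" for n
    unfolding G_def using r_comp by (intro component_Sup) auto
  note G_bounds = component_bounds[OF G_comp]
  have rho_G: "rho (G n) \<le> (2 * (1 / 2) ^ n) *\<^sub>R e" for n
  proof (rule rho_lub_le)
    let ?t = "\<lambda>m. SUP k\<in>{..<Suc m}. r (n + k)"
    show "incseq ?t" by (auto simp: incseq_def intro!: cSUP_subset_mono r_bdd)
    show t0: "0 \<le> ?t m" for m
      using r_bounds(1)[of n] cSUP_upper[OF _ r_bdd, of 0 "{..<Suc m}" n] by simp
    show "?t m \<le> G n" for m
      unfolding G_def by (intro cSUP_subset_mono r_bdd) auto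
    show "G n \<le> u" if "\<And>m. ?t m \<le> u" for u
      unfolding G_def
    proof (intro cSUP_least)
      fix k show "r (n + k) \<le> u"
        using cSUP_upper[OF _ r_bdd, of k "{..<Suc k}" n] that[of k] by (auto intro: order_trans)
    qed simp
    show "rho (?t m) \<le> (2 * (1 / 2) ^ n) *\<^sub>R e" for m
    proof -
      have "?t m \<le> (\<Sum>k<Suc m. r (n + k))"
      proof (intro cSUP_least)
        fix i assume "i \<in> {..<Suc m}"
        then have "(\<Sum>k\<in>{i}. r (n + k)) \<le> (\<Sum>k<Suc m. r (n + k))"
          using r_bounds(1) by (intro sum_mono2) auto
        then show "r (n + i) \<le> (\<Sum>k<Suc m. r (n + k))" by simp
      qed auto
      then have "rho (?t m) \<le> rho (\<Sum>k<Suc m. r (n + k))" using t0 by (intro rho_mono)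
      also have "\<dots> \<le> (\<Sum>k<Suc m. rho (r (n + k)))" using r_bounds(1) by (intro rho_sum)
      also have "\<dots> \<le> (\<Sum>k<Suc m. ((1 / 2) ^ (n + k)) *\<^sub>R e)" by (intro sum_mono rho_r)
      also have "\<dots> = (\<Sum>k<Suc m. (1 / 2) ^ (n + k)) *\<^sub>R e" by (simp only: scaleR_sum_left)
      also have "\<dots> \<le> (2 * (1 / 2) ^ n) *\<^sub>R e" by (intro scaleR_right_mono geometric_sum_le) auto
      finally show ?thesis .
    qed
  qed
  have cov: "covers UNIV (\<lambda>n. j e - G n)"
    unfolding covers_def
  proof (intro allI impI)
    fix f :: 'u assume f: "0 \<le> f" "\<forall>n\<in>UNIV. inf f (j e - G n) = 0"
    have f0: "0 \<le> inf f (j e)" using f by simp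
    have "inf f (j e) = 0"
    proof (rule rho_le_null_sequence[OF f0])
      fix n
      have "inf f (j e) \<le> j e - (j e - G n)"
        by (rule disjoint_le_diff[OF disjoint_mono[of f "j e - G n"]]) (use f0 f G_bounds in auto)
      then have "rho (inf f (j e)) \<le> rho (G n)" using f0 by (intro rho_mono) auto
      with rho_G show "rho (inf f (j e)) \<le> (2 * (1 / 2) ^ n) *\<^sub>R e" by (rule order_trans[rotated])
    qed
    with f(1) show "f = 0" by (rule weak_unit_j)
  qed
  obtain p where p: "\<And>n. component (j e) (p n)" and pG: "\<And>n. p n \<le> j e - G n"
    and disj: "\<And>n k. n \<noteq> k \<Longrightarrow> inf (p n) (p k) = 0" and pcov: "covers UNIV p"
  proof (rule disjoint_refinement[where C = "Collect (component (j e))" and I = UNIV and e = "j e"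
        and a = "\<lambda>n. j e - G n"])
    show "0 \<in> Collect (component (j e))" by (simp add: component_def inf_absorb1)
    show "\<And>D. D \<subseteq> Collect (component (j e)) \<Longrightarrow> D \<noteq> {} \<Longrightarrow> Sup D \<in> Collect (component (j e))"
      by (auto intro: component_Sup)
  qed (use cov G_comp in \<open>auto intro: component_inf component_diff\<close>)
  note p0 = component_bounds(1)[OF p]
  obtain w where w: "\<And>n. inf \<bar>w - (s n + 2 *\<^sub>R j e)\<bar> (p n) = 0"
    using mixing[of UNIV p "\<lambda>n. s n + 2 *\<^sub>R j e"] p0 disj by auto
  have "s m \<le> w" for m
  proof (rule le_of_le_on_cover[OF pcov])
    fix n
    have "le_on (p n) (s m) (s n + 2 *\<^sub>R j e)"
    proof (cases "m \<le> n")
      case True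
      then have "s m \<le> s n" unfolding s_def using d0 by (intro sum_mono2) auto
      then have "s m \<le> s n + 2 *\<^sub>R j e" by (intro add_increasing2) (auto intro: scaleR_nonneg_nonneg)
      then show ?thesis using p0 by (intro le_on_of_le)
    next
      case False
      then obtain i where m: "m = n + i" by (metis le_add_diff_inverse nat_le_linear)
      have inc: "le_on (p n) (d (n + k)) (((1 / 2) ^ (n + k)) *\<^sub>R j e)" for k
      proof (rule le_on_antimono)
        show "le_on (j e - r (n + k)) (d (n + k)) (((1 / 2) ^ (n + k)) *\<^sub>R j e)"
          unfolding r_def by (rule le_on_complement_level_component) simp
        have "r (n + k) \<le> G n" unfolding G_def by (intro cSUP_upper r_bdd) auto
        with pG[of n] show "p n \<le> j e - r (n + k)" by (meson diff_left_mono order_trans)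
      qed (rule p0)
      have "le_on (p n) (\<Sum>k<i. d (n + k)) (\<Sum>k<i. ((1 / 2) ^ (n + k)) *\<^sub>R j e)"
        using p0 inc by (rule le_on_sum)
      moreover have "(\<Sum>k<i. ((1 / 2) ^ (n + k)) *\<^sub>R j e) \<le> 2 *\<^sub>R j e"
      proof -
        have "(\<Sum>k<i. (1 / 2) ^ (n + k)) \<le> 2 * (1 / 2 :: real) ^ n" by (intro geometric_sum_le) auto
        also have "\<dots> \<le> 2" by (simp add: power_le_one)
        finally show ?thesis by (simp flip: scaleR_sum_left add: scaleR_right_mono)
      qed
      ultimately have "le_on (p n) (\<Sum>k<i. d (n + k)) (2 *\<^sub>R j e)"
        using p0 by (meson le_on_of_le le_on_trans)
      then have "le_on (p n) (s n + (\<Sum>k<i. d (n + k))) (s n + 2 *\<^sub>R j e)"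
        by (rule le_on_add[OF p0 le_on_of_le[OF p0 order_refl]])
      moreover have "s m = s n + (\<Sum>k<i. d (n + k))"
        unfolding s_def m by (induction i) (auto simp: algebra_simps)
      ultimately show ?thesis by simp
    qed
    moreover have "le_on (p n) (s n + 2 *\<^sub>R j e) w"
      unfolding le_on_def using p0 pprt_le_abs[of "s n + 2 *\<^sub>R j e - w"]
      by (intro disjoint_mono[OF w[of n]]) (simp_all only: abs_minus_commute zero_le_pprt order_refl)
    ultimately show "le_on (p n) (s m) w" using p0 by (meson le_on_trans)
  qed
  then show ?thesis unfolding s_def by (rule that)
qed

text \<open>With the partial sums \<open>s n\<close> of the absolute increments, \<open>z n + s n\<close> is increasing; so the limit is a
  difference of two suprema, and \<open>\<bar>z n - l\<bar>\<close> is dominated by the tail of the series.\<close>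

lemma rho_sequence_limit:
  fixes z :: "nat \<Rightarrow> 'u"
  assumes z: "\<And>n. rho \<bar>z (Suc n) - z n\<bar> \<le> ((1 / 4) ^ n) *\<^sub>R e"
  obtains l where "\<And>n. rho \<bar>z n - l\<bar> \<le> (2 * (1 / 4) ^ n) *\<^sub>R e"
proof -
  define d where "d k = \<bar>z (Suc k) - z k\<bar>" for k
  define s where "s m = (\<Sum>k<m. d k)" for m
  have d0: "0 \<le> d k" for k by (simp add: d_def)
  obtain w where w: "\<And>m. s m \<le> w"
    using summable_bounded[of d] z d0 by (auto simp: d_def s_def)
  define S where "S = (SUP m. s m)"
  have bdd: "bdd_above (range s)" using w by (auto intro!: bdd_aboveI[of _ w])
  have sS: "s m \<le> S" for m unfolding S_def using bdd by (intro cSUP_upper) auto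
  have s_inc: "incseq s" using d0 by (intro incseq_SucI) (simp add: s_def)
  have s_split: "s (n + m) - s n = (\<Sum>k<m. d (n + k))" for n m
    unfolding s_def by (induction m) (auto simp: algebra_simps)
  have z_inc: "z (n + m) - z n \<le> s (n + m) - s n" for n m
  proof (induction m)
    case (Suc m)
    have "z (Suc (n + m)) - z (n + m) \<le> d (n + m)" by (simp add: d_def abs_ge_self)
    from add_mono[OF Suc this] show ?case by (simp add: s_def algebra_simps)
  qed simp
  define y where "y n = z n + s n" for n
  have y_inc: "incseq y"
  proof (rule incseq_SucI)
    fix n
    have "- (z (Suc n) - z n) \<le> d n" by (simp only: d_def abs_ge_minus_self)
    then show "y n \<le> y (Suc n)" by (simp add: y_def s_def algebra_simps)
  qed
  have y_le: "y m \<le> S + S + z n - s n" for m n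
  proof -
    have "y m \<le> y (n + m)" using y_inc by (auto simp: incseq_def)
    also have "\<dots> \<le> (s (n + m) - s n + z n) + s (n + m)"
      using z_inc[of n m] by (simp add: y_def algebra_simps)
    also have "\<dots> \<le> (S - s n + z n) + S" by (intro add_mono diff_right_mono sS order_refl)
    finally show ?thesis by (simp add: algebra_simps)
  qed
  define l where "l = (SUP n. y n) - S"
  have y_bdd: "bdd_above (range y)"
    using y_le[of _ 0] by (auto intro!: bdd_aboveI[of _ "S + S + z 0 - s 0"])
  have dist: "\<bar>z n - l\<bar> \<le> S - s n" for n
  proof (rule abs_leI)
    have "y n \<le> (SUP n. y n)" using y_bdd by (intro cSUP_upper) auto
    then show "z n - l \<le> S - s n" by (simp add: l_def y_def algebra_simps)
    have "(SUP n. y n) \<le> S + S + z n - s n" using y_le by (intro cSUP_least) auto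
    then show "- (z n - l) \<le> S - s n" by (simp add: l_def algebra_simps)
  qed
  have "rho (S - s n) \<le> (2 * (1 / 4) ^ n) *\<^sub>R e" for n
  proof (rule rho_lub_le)
    let ?t = "\<lambda>m. s (n + m) - s n"
    show "incseq ?t" using s_inc by (auto simp: incseq_def intro: diff_right_mono)
    show "0 \<le> ?t m" for m using s_inc by (auto simp: incseq_def)
    show "?t m \<le> S - s n" for m by (intro diff_right_mono sS)
    show "S - s n \<le> u" if u: "\<And>m. ?t m \<le> u" for u
    proof -
      have "s m \<le> u + s n" for m
      proof -
        have "s m \<le> s (n + m)" using s_inc by (auto simp: incseq_def)
        also have "\<dots> \<le> u + s n" using u[of m] by (simp only: diff_le_eq)
        finally show ?thesis .
      qed
      then have "S \<le> u + s n" unfolding S_def by (intro cSUP_least) auto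
      then show ?thesis by (simp only: diff_le_eq)
    qed
    show "rho (?t m) \<le> (2 * (1 / 4) ^ n) *\<^sub>R e" for m
    proof -
      have "rho (?t m) \<le> (\<Sum>k<m. rho (d (n + k)))" unfolding s_split using d0 by (intro rho_sum)
      also have "\<dots> \<le> (\<Sum>k<m. ((1 / 4) ^ (n + k)) *\<^sub>R e)"
        using z by (intro sum_mono) (simp add: d_def)
      also have "\<dots> = (\<Sum>k<m. (1 / 4) ^ (n + k)) *\<^sub>R e" by (simp only: scaleR_sum_left)
      also have "\<dots> \<le> (2 * (1 / 4) ^ n) *\<^sub>R e" by (intro scaleR_right_mono geometric_sum_le) auto
      finally show ?thesis .
    qed
  qed
  moreover have "rho \<bar>z n - l\<bar> \<le> rho (S - s n)" for n using dist by (intro rho_mono) auto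
  ultimately show ?thesis using that order_trans by blast
qed

section \<open>From Cauchy nets to Cauchy sequences\<close>

definition invariant_component :: "'a \<Rightarrow> bool" where
  "invariant_component p \<longleftrightarrow> component e p \<and> T p = p"

lemma invariant_component_0: "invariant_component 0"
  by (simp add: invariant_component_def component_def inf_absorb1)

lemma invariant_component_diff: "invariant_component p \<Longrightarrow> invariant_component (e - p)"
  by (simp add: invariant_component_def component_diff T_diff)

lemma invariant_component_inf:
  "invariant_component p \<Longrightarrow> invariant_component q \<Longrightarrow> invariant_component (inf p q)"
  by (simp add: invariant_component_def component_inf range_T_closed)

lemma invariant_component_Sup:
  assumes "D \<noteq> {}" "\<And>d. d \<in> D \<Longrightarrow> invariant_component d"
  shows "invariant_component (Sup D)"
  unfolding invariant_component_def
proof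
  have D: "component e d" "T d = d" if "d \<in> D" for d
    using assms(2)[OF that] by (auto simp: invariant_component_def)
  show "component e (Sup D)" using assms(1) D(1) by (rule component_Sup)
  have "bdd_above D" by (rule bdd_aboveI[of _ e]) (rule component_bounds(2)[OF D(1)])
  with assms(1) show "T (Sup D) = Sup D" using D(2) by (rule T_Sup)
qed

text \<open>The component is built from \<open>q\<close> and \<open>e\<close> by lattice operations and a supremum, under all of which the
  range of \<open>T\<close> is closed.\<close>

lemma invariant_component_level:
  assumes "T q = q"
  shows "invariant_component (band_part (pprt (q - c *\<^sub>R e)) e)"
  unfolding invariant_component_def
proof
  show "component e (band_part (pprt (q - c *\<^sub>R e)) e)" by (rule component_band_part) auto
  have "T (pprt (q - c *\<^sub>R e)) = pprt (q - c *\<^sub>R e)"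
    unfolding pprt_def using assms by (simp add: range_T_closed)
  then show "T (band_part (pprt (q - c *\<^sub>R e)) e) = band_part (pprt (q - c *\<^sub>R e)) e"
    unfolding band_part_def
    by (intro T_Sup) (auto intro!: bdd_aboveI[of _ e] simp: range_T_closed)
qed

text \<open>The net is eventually within \<open>c\<close> of \<open>z\<close>, but the index after which this holds may vary over a
  family of \<open>T\<close>-invariant components that covers \<open>e\<close>. Order convergence provides no index that works everywhere, so
  nothing stronger can be expected of a Cauchy net.\<close>

definition locally_near :: "'i set \<Rightarrow> ('i \<Rightarrow> 'i \<Rightarrow> bool) \<Rightarrow> ('i \<Rightarrow> 'u) \<Rightarrow> real \<Rightarrow> 'u \<Rightarrow> bool" where
  "locally_near A le x c z \<longleftrightarrow> (\<exists>p. covers A p \<and> (\<forall>\<alpha>\<in>A. invariant_component (p \<alpha>)) \<and>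
     (\<forall>\<alpha>\<in>A. \<forall>\<beta>\<in>A. le \<alpha> \<beta> \<longrightarrow> le_on (p \<alpha>) (rho \<bar>x \<beta> - z\<bar>) (c *\<^sub>R e)))"

lemma invariant_component_nonneg: "invariant_component p \<Longrightarrow> 0 \<le> p"
  by (auto simp: invariant_component_def intro: component_bounds)

text \<open>On each intersection of a piece for \<open>z\<close> with a piece for \<open>z'\<close>, directedness supplies a member of the net
  that is near to both.\<close>

lemma locally_near_dist:
  assumes dir: "directed_set A le"
    and z: "locally_near A le x c z" and z': "locally_near A le x c' z'"
  shows "rho \<bar>z - z'\<bar> \<le> (c + c') *\<^sub>R e"
proof -
  obtain p where p: "covers A p" "\<And>\<alpha>. \<alpha> \<in> A \<Longrightarrow> invariant_component (p \<alpha>)"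
    "\<And>\<alpha> \<beta>. \<alpha> \<in> A \<Longrightarrow> \<beta> \<in> A \<Longrightarrow> le \<alpha> \<beta> \<Longrightarrow> le_on (p \<alpha>) (rho \<bar>x \<beta> - z\<bar>) (c *\<^sub>R e)"
    using z unfolding locally_near_def by blast
  obtain p' where p': "covers A p'" "\<And>\<alpha>. \<alpha> \<in> A \<Longrightarrow> invariant_component (p' \<alpha>)"
    "\<And>\<alpha> \<beta>. \<alpha> \<in> A \<Longrightarrow> \<beta> \<in> A \<Longrightarrow> le \<alpha> \<beta> \<Longrightarrow> le_on (p' \<alpha>) (rho \<bar>x \<beta> - z'\<bar>) (c' *\<^sub>R e)"
    using z' unfolding locally_near_def by blast
  have both: "le_on (inf (p \<alpha>) (p' \<beta>)) (rho \<bar>z - z'\<bar>) ((c + c') *\<^sub>R e)"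
    if ab: "\<alpha> \<in> A" "\<beta> \<in> A" for \<alpha> \<beta>
  proof -
    let ?q = "inf (p \<alpha>) (p' \<beta>)"
    have q0: "0 \<le> ?q" using p(2) p'(2) ab by (simp add: invariant_component_nonneg)
    obtain \<gamma> where \<gamma>: "\<gamma> \<in> A" "le \<alpha> \<gamma>" "le \<beta> \<gamma>" using dir ab unfolding directed_set_def by blast
    have "le_on ?q (rho \<bar>x \<gamma> - z\<bar>) (c *\<^sub>R e)" "le_on ?q (rho \<bar>x \<gamma> - z'\<bar>) (c' *\<^sub>R e)"
      using le_on_antimono[OF p(3)[OF ab(1) \<gamma>(1,2)] q0]
        le_on_antimono[OF p'(3)[OF ab(2) \<gamma>(1,3)] q0] by simp_all
    then have "le_on ?q (rho \<bar>x \<gamma> - z\<bar> + rho \<bar>x \<gamma> - z'\<bar>) ((c + c') *\<^sub>R e)"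
      using q0 by (simp add: le_on_add scaleR_left_distrib)
    moreover have "rho \<bar>z - z'\<bar> \<le> rho \<bar>x \<gamma> - z\<bar> + rho \<bar>x \<gamma> - z'\<bar>"
      using rho_triangle[of z z' "x \<gamma>"] by (simp only: abs_minus_commute)
    ultimately show ?thesis using q0 by (meson le_on_of_le le_on_trans)
  qed
  show ?thesis
  proof (rule le_of_le_on_cover[OF p(1)])
    fix \<alpha> assume \<alpha>: "\<alpha> \<in> A"
    have "\<forall>\<beta>\<in>A. inf (inf (pprt (rho \<bar>z - z'\<bar> - (c + c') *\<^sub>R e)) (p \<alpha>)) (p' \<beta>) = 0"
      using both[OF \<alpha>] by (simp add: le_on_def inf_assoc)
    moreover have "0 \<le> inf (pprt (rho \<bar>z - z'\<bar> - (c + c') *\<^sub>R e)) (p \<alpha>)"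
      using p(2)[OF \<alpha>] by (simp add: invariant_component_nonneg)
    ultimately show "le_on (p \<alpha>) (rho \<bar>z - z'\<bar>) ((c + c') *\<^sub>R e)"
      using p'(1) unfolding covers_def le_on_def by blast
  qed
qed

lemma locally_near_move:
  assumes z: "locally_near A le x c z" and l: "rho \<bar>z - l\<bar> \<le> c' *\<^sub>R e" and c'': "c + c' \<le> c''"
  shows "locally_near A le x c'' l"
proof -
  obtain p where p: "covers A p" "\<forall>\<alpha>\<in>A. invariant_component (p \<alpha>)"
    "\<forall>\<alpha>\<in>A. \<forall>\<beta>\<in>A. le \<alpha> \<beta> \<longrightarrow> le_on (p \<alpha>) (rho \<bar>x \<beta> - z\<bar>) (c *\<^sub>R e)"
    using z unfolding locally_near_def by blast
  have "le_on (p \<alpha>) (rho \<bar>x \<beta> - l\<bar>) (c'' *\<^sub>R e)" if ab: "\<alpha> \<in> A" "\<beta> \<in> A" "le \<alpha> \<beta>" for \<alpha> \<beta>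
  proof -
    have p0: "0 \<le> p \<alpha>" using p(2) ab by (simp add: invariant_component_nonneg)
    have "le_on (p \<alpha>) (rho \<bar>x \<beta> - z\<bar> + rho \<bar>z - l\<bar>) (c *\<^sub>R e + c' *\<^sub>R e)"
      by (rule le_on_add[OF p0 _ le_on_of_le[OF p0 l]]) (use p(3) ab in blast)
    moreover have "c *\<^sub>R e + c' *\<^sub>R e \<le> c'' *\<^sub>R e"
      using c'' by (simp flip: scaleR_left_distrib add: scaleR_right_mono)
    ultimately show ?thesis
      using p0 rho_triangle[of "x \<beta>" l z] by (meson le_on_of_le le_on_trans)
  qed
  then show ?thesis unfolding locally_near_def using p(1,2) by blast
qed

lemma converges_of_locally_near:
  assumes dir: "directed_set A le" and near: "\<And>c. 0 < c \<Longrightarrow> locally_near A le x c l"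
  shows "converges_in_cond_prob j e T A le x l"
  unfolding converges_in_cond_prob_iff_rho[OF dir]
proof (rule order_convergent_0I[OF dir])
  fix w assume w: "\<And>y. y \<in> eventual_bounds A le (\<lambda>\<alpha>. rho \<bar>x \<alpha> - l\<bar>) \<Longrightarrow> w \<le> y"
  show "w \<le> 0"
  proof (rule le_zero_of_le_scaleR)
    fix c :: real assume c: "0 < c"
    obtain p where p: "covers A p" "\<And>\<alpha>. \<alpha> \<in> A \<Longrightarrow> invariant_component (p \<alpha>)"
      "\<And>\<alpha> \<beta>. \<alpha> \<in> A \<Longrightarrow> \<beta> \<in> A \<Longrightarrow> le \<alpha> \<beta> \<Longrightarrow> le_on (p \<alpha>) (rho \<bar>x \<beta> - l\<bar>) (c *\<^sub>R e)"
      using near[OF c] unfolding locally_near_def by blast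
    show "w \<le> c *\<^sub>R e"
    proof (rule le_of_le_on_cover[OF p(1)])
      fix \<alpha> assume \<alpha>: "\<alpha> \<in> A"
      have comp: "component e (p \<alpha>)" using p(2)[OF \<alpha>] by (simp add: invariant_component_def)
      \<comment> \<open>On \<open>p \<alpha>\<close> the bound \<open>c e\<close> holds from \<open>\<alpha>\<close> on; elsewhere \<open>e\<close> is a bound.\<close>
      have "rho \<bar>x \<beta> - l\<bar> \<le> c *\<^sub>R e + (e - p \<alpha>)" if \<beta>: "\<beta> \<in> A" "le \<alpha> \<beta>" for \<beta>
      proof -
        have "rho \<bar>x \<beta> - l\<bar> \<le> e + c *\<^sub>R e"
          using c by (intro add_increasing2 rho_le_e) (auto intro: scaleR_nonneg_nonneg)
        then have "pprt (rho \<bar>x \<beta> - l\<bar> - c *\<^sub>R e) \<le> e" by (simp add: pprt_def diff_le_eq)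
        then have "pprt (rho \<bar>x \<beta> - l\<bar> - c *\<^sub>R e) \<le> e - p \<alpha>"
          using p(3)[OF \<alpha> \<beta>] component_bounds(2)[OF comp]
          by (intro disjoint_le_diff) (auto simp: le_on_def)
        then have "rho \<bar>x \<beta> - l\<bar> - c *\<^sub>R e \<le> e - p \<alpha>" unfolding pprt_def by simp
        then show ?thesis by (simp add: algebra_simps)
      qed
      then have "w \<le> c *\<^sub>R e + (e - p \<alpha>)"
        using \<alpha> by (intro w) (auto simp: eventual_bounds_def)
      then have "w - c *\<^sub>R e \<le> e - p \<alpha>" by (simp add: algebra_simps)
      then have "pprt (w - c *\<^sub>R e) \<le> e - p \<alpha>"
        using component_bounds(2)[OF comp] by (simp add: pprt_def)
      then show "le_on (p \<alpha>) w (c *\<^sub>R e)"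
        unfolding le_on_def using component_bounds[OF comp]
        by (intro disjoint_mono[OF component_disjoint[OF comp]]) auto
    qed
  qed
qed (simp add: rho_nonneg)

text \<open>The oscillations \<open>q \<alpha>\<close> of the net beyond \<open>\<alpha>\<close> are \<open>T\<close>-invariant with infimum \<open>0\<close>, so the components
  on which \<open>q \<alpha> \<le> c e\<close> cover \<open>e\<close>. Made disjoint, they serve to mix \<open>z\<close> out of the \<open>x \<alpha>\<close>.\<close>

lemma cauchy_locally_near:
  assumes dir: "directed_set A le" and cauchy: "cauchy_in_cond_prob j e T A le x" and c: "0 < c"
  shows "\<exists>z. locally_near A le x c z"
proof -
  define le2 where "le2 = (\<lambda>(\<alpha>, \<beta>) (\<alpha>', \<beta>'). le \<alpha> \<alpha>' \<and> le \<beta> \<beta>')"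
  have refl: "le \<alpha> \<alpha>" if "\<alpha> \<in> A" for \<alpha>
    using dir that by (auto simp: directed_set_def reflp_on_def)
  have trans: "le \<alpha> \<gamma>" if "le \<alpha> \<beta>" "le \<beta> \<gamma>" "\<alpha> \<in> A" "\<beta> \<in> A" "\<gamma> \<in> A" for \<alpha> \<beta> \<gamma>
    using dir that unfolding directed_set_def transp_on_def by blast
  have upper: "\<exists>\<gamma>\<in>A. le \<alpha> \<gamma> \<and> le \<beta> \<gamma>" if "\<alpha> \<in> A" "\<beta> \<in> A" for \<alpha> \<beta>
    using dir that unfolding directed_set_def by blast
  have dir2: "directed_set (A \<times> A) le2"
    unfolding directed_set_def
  proof (intro conjI ballI)
    show "A \<times> A \<noteq> {}" using dir by (auto simp: directed_set_def)
    show "reflp_on (A \<times> A) le2" using refl by (auto simp: reflp_on_def le2_def)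
    show "transp_on (A \<times> A) le2" using trans by (auto simp: transp_on_def le2_def)
    fix a b assume "a \<in> A \<times> A" "b \<in> A \<times> A"
    moreover from this obtain \<gamma> \<delta> where "\<gamma> \<in> A" "le (fst a) \<gamma>" "le (fst b) \<gamma>"
      "\<delta> \<in> A" "le (snd a) \<delta>" "le (snd b) \<delta>"
      using upper[of "fst a" "fst b"] upper[of "snd a" "snd b"] by (auto simp: mem_Times_iff)
    ultimately show "\<exists>c\<in>A \<times> A. le2 a c \<and> le2 b c"
      by (intro bexI[of _ "(\<gamma>, \<delta>)"]) (auto simp: le2_def split: prod.splits)
  qed
  have conv: "order_convergent (A \<times> A) le2 (\<lambda>p. rho \<bar>x (fst p) - x (snd p)\<bar>) 0"
    using cauchy
    unfolding cauchy_in_cond_prob_def le2_def[symmetric] converges_in_cond_prob_iff_rho[OF dir2]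
    by (simp add: case_prod_beta)
  define S where "S \<alpha> = {rho \<bar>x \<beta> - x \<gamma>\<bar> |\<beta> \<gamma>. \<beta> \<in> A \<and> \<gamma> \<in> A \<and> le \<alpha> \<beta> \<and> le \<alpha> \<gamma>}" for \<alpha>
  define q where "q \<alpha> = Sup (S \<alpha>)" for \<alpha>
  have S_ne: "S \<alpha> \<noteq> {}" if "\<alpha> \<in> A" for \<alpha> using refl that by (auto simp: S_def)
  have S_bdd: "bdd_above (S \<alpha>)" for \<alpha>
    by (rule bdd_aboveI[of _ e]) (auto simp: S_def rho_le_e)
  have q_upper: "rho \<bar>x \<beta> - x \<gamma>\<bar> \<le> q \<alpha>" if "\<beta> \<in> A" "\<gamma> \<in> A" "le \<alpha> \<beta>" "le \<alpha> \<gamma>" for \<alpha> \<beta> \<gamma>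
    unfolding q_def using that S_bdd by (intro cSup_upper) (auto simp: S_def)
  have q_nonneg: "0 \<le> q \<alpha>" if "\<alpha> \<in> A" for \<alpha>
    using q_upper[of \<alpha> \<alpha> \<alpha>] refl that rho_nonneg[of "\<bar>x \<alpha> - x \<alpha>\<bar>"] by (meson abs_ge_zero order_trans)
  have Tq: "T (q \<alpha>) = q \<alpha>" if "\<alpha> \<in> A" for \<alpha>
    unfolding q_def using S_ne[OF that] S_bdd by (intro T_Sup) (auto simp: S_def T_rho)
  have q_inf: "w \<le> 0" if w: "\<And>\<alpha>. \<alpha> \<in> A \<Longrightarrow> w \<le> q \<alpha>" for w
  proof (rule order_convergent_0D[OF _ conv])
    fix y assume "y \<in> eventual_bounds (A \<times> A) le2 (\<lambda>p. rho \<bar>x (fst p) - x (snd p)\<bar>)"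
    then obtain \<alpha> \<beta> where ab: "\<alpha> \<in> A" "\<beta> \<in> A"
      "\<And>\<alpha>' \<beta>'. \<alpha>' \<in> A \<Longrightarrow> \<beta>' \<in> A \<Longrightarrow> le \<alpha> \<alpha>' \<Longrightarrow> le \<beta> \<beta>' \<Longrightarrow> rho \<bar>x \<alpha>' - x \<beta>'\<bar> \<le> y"
      unfolding eventual_bounds_def le2_def by fastforce
    obtain \<gamma> where \<gamma>: "\<gamma> \<in> A" "le \<alpha> \<gamma>" "le \<beta> \<gamma>" using upper ab by blast
    have "q \<gamma> \<le> y"
      unfolding q_def
    proof (rule cSup_least[OF S_ne[OF \<gamma>(1)]])
      fix v assume "v \<in> S \<gamma>"
      then obtain \<alpha>' \<beta>' where v: "v = rho \<bar>x \<alpha>' - x \<beta>'\<bar>"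
        and in_A: "\<alpha>' \<in> A" "\<beta>' \<in> A" and le: "le \<gamma> \<alpha>'" "le \<gamma> \<beta>'" by (auto simp: S_def)
      show "v \<le> y"
        unfolding v using in_A trans[OF \<gamma>(2) le(1)] trans[OF \<gamma>(3) le(2)] ab \<gamma>(1)
        by (intro ab(3))
    qed
    with w[OF \<gamma>(1)] show "w \<le> y" by (rule order_trans)
  qed (simp add: rho_nonneg)
  define b where "b \<alpha> = band_part (pprt (q \<alpha> - c *\<^sub>R e)) e" for \<alpha>
  have b: "invariant_component (b \<alpha>)" if "\<alpha> \<in> A" for \<alpha>
    unfolding b_def using Tq[OF that] by (rule invariant_component_level)
  have cov: "covers A (\<lambda>\<alpha>. e - b \<alpha>)"
    unfolding covers_def
  proof (intro allI impI)
    fix f :: 'a assume f: "0 \<le> f" "\<forall>\<alpha>\<in>A. inf f (e - b \<alpha>) = 0"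
    have "c *\<^sub>R inf f e \<le> q \<alpha>" if \<alpha>: "\<alpha> \<in> A" for \<alpha>
    proof -
      have bd: "0 \<le> b \<alpha>" "b \<alpha> \<le> e"
        using b[OF \<alpha>] by (auto simp: invariant_component_def intro: component_bounds)
      have "inf f e \<le> e - (e - b \<alpha>)"
        by (rule disjoint_le_diff[OF disjoint_mono[of f "e - b \<alpha>"]]) (use f \<alpha> bd in auto)
      then have "c *\<^sub>R inf f e \<le> c *\<^sub>R b \<alpha>" using c by (intro scaleR_left_mono) auto
      also have "\<dots> \<le> q \<alpha>"
        unfolding b_def using c q_nonneg[OF \<alpha>] by (intro scaleR_level_component_le) auto
      finally show ?thesis .
    qed
    then have "c *\<^sub>R inf f e \<le> 0" by (rule q_inf)
    then have "(1 / c) *\<^sub>R (c *\<^sub>R inf f e) \<le> (1 / c) *\<^sub>R 0" using c by (intro scaleR_left_mono) auto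
    then have "inf f e \<le> 0" using c by simp
    then have "inf \<bar>f\<bar> e = 0" using f(1) by (intro antisym) auto
    then show "f = 0" by (rule weak_unit)
  qed
  obtain p where p: "\<And>\<alpha>. \<alpha> \<in> A \<Longrightarrow> invariant_component (p \<alpha>)" "\<And>\<alpha>. \<alpha> \<in> A \<Longrightarrow> p \<alpha> \<le> e - b \<alpha>"
    "\<And>\<alpha> \<beta>. \<alpha> \<in> A \<Longrightarrow> \<beta> \<in> A \<Longrightarrow> \<alpha> \<noteq> \<beta> \<Longrightarrow> inf (p \<alpha>) (p \<beta>) = 0" "covers A p"
  proof (rule disjoint_refinement[where C = "Collect invariant_component" and I = A and e = e
        and a = "\<lambda>\<alpha>. e - b \<alpha>"])
    show "\<And>D. D \<subseteq> Collect invariant_component \<Longrightarrow> D \<noteq> {} \<Longrightarrow> Sup D \<in> Collect invariant_component"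
      by (auto intro: invariant_component_Sup)
    show "\<And>p. p \<in> Collect invariant_component \<Longrightarrow> component e p"
      by (simp add: invariant_component_def)
  qed (use cov b in \<open>auto intro: invariant_component_0 invariant_component_inf invariant_component_diff\<close>)
  have p0: "0 \<le> p \<alpha>" if "\<alpha> \<in> A" for \<alpha> using p(1)[OF that] by (rule invariant_component_nonneg)
  obtain z where z: "\<And>\<alpha>. \<alpha> \<in> A \<Longrightarrow> inf \<bar>z - x \<alpha>\<bar> (j (p \<alpha>)) = 0"
    using mixing[of A "\<lambda>\<alpha>. j (p \<alpha>)" x] p0 p(3) by (auto simp flip: j_inf)
  have "le_on (p \<alpha>) (rho \<bar>x \<beta> - z\<bar>) (c *\<^sub>R e)" if ab: "\<alpha> \<in> A" "\<beta> \<in> A" "le \<alpha> \<beta>" for \<alpha> \<beta>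
  proof -
    have "inf (rho \<bar>z - x \<alpha>\<bar>) (p \<alpha>) = 0"
      using p(1)[OF ab(1)] z[OF ab(1)] by (intro rho_disjoint) (auto simp: invariant_component_def)
    then have "le_on (p \<alpha>) (rho \<bar>x \<alpha> - z\<bar>) 0"
      by (simp add: le_on_def rho_nonneg abs_minus_commute)
    moreover have "le_on (p \<alpha>) (rho \<bar>x \<beta> - x \<alpha>\<bar>) (c *\<^sub>R e)"
    proof (rule le_on_trans[OF p0])
      show "le_on (p \<alpha>) (rho \<bar>x \<beta> - x \<alpha>\<bar>) (q \<alpha>)"
        using ab refl p0 by (intro le_on_of_le q_upper) auto
      show "le_on (p \<alpha>) (q \<alpha>) (c *\<^sub>R e)"
        using p(2)[OF ab(1)] p0[OF ab(1)] unfolding b_def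
        by (intro le_on_antimono[OF le_on_complement_level_component[OF e_nonneg]])
    qed (rule ab)
    ultimately have "le_on (p \<alpha>) (rho \<bar>x \<beta> - x \<alpha>\<bar> + rho \<bar>x \<alpha> - z\<bar>) (c *\<^sub>R e + 0)"
      using p0[OF ab(1)] by (intro le_on_add)
    then show ?thesis
      using p0[OF ab(1)] rho_triangle[of "x \<beta>" z "x \<alpha>"] by (auto intro: le_on_of_le le_on_trans)
  qed
  then show ?thesis unfolding locally_near_def using p(1,4) by blast
qed

lemma cauchy_converges:
  assumes dir: "directed_set A le" and cauchy: "cauchy_in_cond_prob j e T A le x"
  shows "\<exists>l. converges_in_cond_prob j e T A le x l"
proof -
  obtain z where z: "\<And>n. locally_near A le x ((1 / 4) ^ Suc n) (z n)"
  proof -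
    have "\<exists>z. locally_near A le x ((1 / 4) ^ Suc n) z" for n
      by (rule cauchy_locally_near[OF dir cauchy]) simp
    then show ?thesis using that by metis
  qed
  have "rho \<bar>z (Suc n) - z n\<bar> \<le> ((1 / 4) ^ n) *\<^sub>R e" for n
  proof -
    have "rho \<bar>z (Suc n) - z n\<bar> \<le> ((1 / 4) ^ Suc (Suc n) + (1 / 4) ^ Suc n) *\<^sub>R e"
      by (rule locally_near_dist[OF dir z z])
    also have "\<dots> \<le> ((1 / 4) ^ n) *\<^sub>R e" by (intro scaleR_right_mono) auto
    finally show ?thesis .
  qed
  then obtain l where l: "\<And>n. rho \<bar>z n - l\<bar> \<le> (2 * (1 / 4) ^ n) *\<^sub>R e"
    using rho_sequence_limit[of z] by blast
  have "locally_near A le x c l" if "0 < c" for c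
  proof -
    obtain n where n: "(1 / 4) ^ n < c / 3" using real_arch_pow_inv[of "c / 3" "1 / 4"] \<open>0 < c\<close> by auto
    show ?thesis by (rule locally_near_move[OF z[of n] l[of n]]) (use n \<open>0 < c\<close> in simp)
  qed
  then show ?thesis using converges_of_locally_near[OF dir] by blast
qed

end

theorem theorem22:
  fixes e :: "'a::dedekind_complete_riesz_space"
    and T :: "'a \<Rightarrow> 'a"
    and j :: "'a \<Rightarrow> 'u::universally_complete_riesz_space"
    and A :: "'i set"
    and le :: "'i \<Rightarrow> 'i \<Rightarrow> bool"
    and x :: "'i \<Rightarrow> 'u"
  assumes "conditional_riesz_triple e T"
    and "universal_completion j"
    and "directed_set A le"
    and "cauchy_in_cond_prob j e T A le x"
  shows "\<exists>l. converges_in_cond_prob j e T A le x l"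
proof -
  interpret cond_triple e T j using assms(1,2) by unfold_locales
  show ?thesis using assms(3,4) by (rule cauchy_converges)
qed

end
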